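(* Let $f$ be a polynomial of the form $f(z)=z+az^{m+1}+(\text{higher order terms})$ with $m\ge 1$ an integer and $a\in\mathbb{C}$, $a\neq 0$. Let $\mathbf{v}_j$ be an attraction vector of $f$ at $0$, let $\mathcal{A}_j=\mathcal{A}(0,\mathbf{v}_j)$ be the associated parabolic basin of attraction, and let $\mathcal{P}_j$ be an attracting petal for $f$ for the vector $\mathbf{v}_j$ at $0$. Let $C>0$, let $q\in\mathcal{P}_j$ be a point on the ray $\{t\mathbf{v}_j:t>0\}$, and let $Q=\bigcup_{l,k\ge0}f^{-l}(f^k(q))$, where $l,k$ range over the non-negative integers. Let $\Omega_{i,j}$ ($i=1,2,\dots$) be the connected components of $\mathcal{A}_j$. Let $X\subset\mathcal{A}_j$ be the set of all $z_0\in\mathcal{A}_j$ such that $d_{\Omega_{i,j}}(z_0,\tilde q)\ge C$ for every $\tilde q\in Q$ lying in the same connected component $\Omega_{i,j}$ of $\mathcal{A}_j$ as $z_0$. If $z\in X$, then every point $w\in f^{-1}(z)$ is in $X$. Hence $X$ is dense in the boundary of $\mathcal{A}_j$, i.e. every point of $\partial\mathcal{A}_j$ lies in the closure of $X$.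
   Context: $f^k$ denotes the $k$-fold iterate of $f$ and $f^{-l}(w)=\{z\in\mathbb{C}: f^l(z)=w\}$ (with $f^0=\mathrm{id}$). Attraction vector: a complex number $\mathbf{v}$ is an attraction vector of $f$ at $0$ if $ma\mathbf{v}^m=-1$; there are $m$ of them. Parabolic basin: $\mathcal{A}(0,\mathbf{v}_j)$ is the set of all $z_0\in\mathbb{C}$ whose orbit $z_k=f^k(z_0)$ converges to $0$ with no $z_k$ equal to $0$, and from the direction $\mathbf{v}_j$, i.e. $z_k\sim \mathbf{v}_j/\sqrt[m]{k}$ as $k\to\infty$ (that is, $\lim_{k\to\infty}\sqrt[m]{k}\,z_k=\mathbf{v}_j$). Attracting petal: let $N$ be a neighborhood of $0$ on which $f$ is univalent. An open set $\mathcal{P}_j\subset N$ is an attracting petal for $f$ for the vector $\mathbf{v}_j$ at $0$ if (1) $f(\mathcal{P}_j)\subset\mathcal{P}_j$, and (2) an orbit $z_0\mapsto z_1\mapsto\cdots$ under $f$ is eventually absorbed by $\mathcal{P}_j$ if and only if it converges to $0$ from the direction $\mathbf{v}_j$. Kobayashi metric and distance: let $\Delta$ be the open unit disk. For a domain $\Omega\subset\mathbb{C}$, $z\in\Omega$ and $\xi\in\mathbb{C}$, put $F_\Omega(z,\xi)=\inf\{\lambda>0:\ \exists\, g:\Delta\to\Omega \text{ holomorphic with } g(0)=z,\ \lambda g'(0)=\xi\}$. The length of a piecewise smooth curve $\gamma:[0,1]\to\Omega$ is $L_\Omega(\gamma)=\int_0^1F_\Omega(\gamma(t),\gamma'(t))\,dt$,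 and $d_\Omega(z_1,z_2)=\inf L_\Omega(\gamma)$ over piecewise smooth curves $\gamma$ in $\Omega$ joining $z_1$ to $z_2$. *)

theory Defs
  imports "HOL-Complex_Analysis.Complex_Analysis" "HOL-Computational_Algebra.Polynomial"
begin

definition attraction_vector :: "nat \<Rightarrow> complex \<Rightarrow> complex \<Rightarrow> bool" where
  "attraction_vector m a v \<longleftrightarrow> of_nat m * a * v ^ m = -1"

definition converges_from_direction ::
    "(complex \<Rightarrow> complex) \<Rightarrow> nat \<Rightarrow> complex \<Rightarrow> complex \<Rightarrow> bool" where
  "converges_from_direction f m v z \<longleftrightarrow>
     (\<lambda>k. (f ^^ k) z) \<longlonglongrightarrow> 0 \<and>
     (\<forall>k. (f ^^ k) z \<noteq> 0) \<and>
     (\<lambda>k. complex_of_real (root m (real k)) * (f ^^ k) z) \<longlonglongrightarrow> v"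

definition parabolic_basin ::
    "(complex \<Rightarrow> complex) \<Rightarrow> nat \<Rightarrow> complex \<Rightarrow> complex set" where
  "parabolic_basin f m v = {z. converges_from_direction f m v z}"

definition attracting_petal ::
    "(complex \<Rightarrow> complex) \<Rightarrow> nat \<Rightarrow> complex \<Rightarrow> complex set \<Rightarrow> bool" where
  "attracting_petal f m v P \<longleftrightarrow>
     open P \<and>
     (\<exists>N. open N \<and> 0 \<in> N \<and> f holomorphic_on N \<and> inj_on f N \<and> P \<subseteq> N) \<and>
     f ` P \<subseteq> P \<and>
     (\<forall>z. (\<forall>\<^sub>F k in sequentially. (f ^^ k) z \<in> P) \<longleftrightarrow> converges_from_direction f m v z)"

definition kobayashi_metric :: "complex set \<Rightarrow> complex \<Rightarrow> complex \<Rightarrow> real" where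
  "kobayashi_metric \<Omega> z \<xi> =
     Inf {r. r > 0 \<and> (\<exists>g. g holomorphic_on ball 0 1 \<and> g ` ball 0 1 \<subseteq> \<Omega> \<and>
                          g 0 = z \<and> complex_of_real r * deriv g 0 = \<xi>)}"

(* Values in ennreal: a valid_path is C1 only off a finite set, where its derivative
   may blow up, and a path of infinite length must not get the length 0 that a
   real-valued integral would assign to it. *)
definition kobayashi_length :: "complex set \<Rightarrow> (real \<Rightarrow> complex) \<Rightarrow> ennreal" where
  "kobayashi_length \<Omega> \<gamma> =
     (\<integral>\<^sup>+ t\<in>{0..1}. ennreal (kobayashi_metric \<Omega> (\<gamma> t) (vector_derivative \<gamma> (at t))) \<partial>lborel)"

definition kobayashi_dist :: "complex set \<Rightarrow> complex \<Rightarrow> complex \<Rightarrow> ennreal" where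
  "kobayashi_dist \<Omega> z w =
     Inf {kobayashi_length \<Omega> \<gamma> | \<gamma>. valid_path \<gamma> \<and> path_image \<gamma> \<subseteq> \<Omega> \<and>
                                     pathstart \<gamma> = z \<and> pathfinish \<gamma> = w}"

end

theory Submission imports Defs begin

text \<open>
  In the coordinate \<open>w = (v / z) ^ m\<close> the polynomial is a perturbation of \<open>w \<mapsto> w + 1\<close>, so every sector
  around the positive \<open>w\<close>-axis with opening less than \<open>2 * pi\<close> lies, near infinity, in the basin, and its
  orbits stay close to \<open>0\<close>. Since \<open>f\<close> is injective near \<open>0\<close>, the grand orbit \<open>Q\<close> of \<open>q\<close> meets such a sector
  only in the forward orbit of \<open>q\<close>, which is tangent to the axis; hence \<open>Q\<close> avoids \<open>pi / 2 \<le> arg w \<le> pi - b\<close>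
  near infinity. On the other hand, there are points outside the basin at every scale close to the negative
  \<open>w\<close>-axis. By Schottky's theorem the Kobayashi metric of the basin is therefore at least a multiple of
  \<open>\<bar>d log w\<bar> / y\<close> at argument \<open>pi - y\<close>. So a path from argument \<open>pi - \<eta>\<close> that leaves the sector
  \<open>b < y < 1/8\<close> is long when \<open>b\<close>, \<open>\<eta>\<close>, \<open>1/8\<close> are of very different sizes, and \<open>X\<close> is not empty.

  Backward invariance of \<open>X\<close> holds because \<open>f\<close> does not increase Kobayashi distances. If some disc around a
  frontier point missed \<open>X\<close>, the iterates would omit there a point of \<open>X\<close> and its preimage, so they would be
  locally bounded and converge to \<open>0\<close>; the direction of convergence is locally constant, so that the
  frontier point would lie in the open basin.
\<close>

section \<open>Logarithmic coordinates at the parabolic point\<close>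

text \<open>Stolz-Cesaro with denominators n: once the increments are within e/2 of c, the earlier
  error is a constant, which n * e/2 eventually exceeds. It turns the approximate translation w -> w
  + 1 into w_n ~ n.\<close>

lemma tendsto_divide_nat_of_increments:
  fixes x :: "nat \<Rightarrow> complex"
  assumes "(\<lambda>n. x (Suc n) - x n) \<longlonglongrightarrow> c"
  shows "(\<lambda>n. x n / of_nat n) \<longlonglongrightarrow> c"
proof (rule LIMSEQ_I)
  fix e :: real assume e: "e > 0"
  obtain N where N: "\<And>n. n \<ge> N \<Longrightarrow> norm (x (Suc n) - x n - c) < e / 2"
    using LIMSEQ_D[OF assms, of "e/2"] e by auto
  have lin: "norm (x (N + k) - x N - of_nat k * c) \<le> of_nat k * (e / 2)" for k
  proof (induction k)
    case 0 show ?case by simp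
  next
    case (Suc k)
    have "x (N + Suc k) - x N - of_nat (Suc k) * c
        = (x (N + k) - x N - of_nat k * c) + (x (Suc (N + k)) - x (N + k) - c)"
      by (simp add: algebra_simps)
    also have "norm \<dots> \<le> of_nat k * (e / 2) + e / 2"
      using Suc N[of "N + k"] by (intro norm_triangle_mono) auto
    finally show ?case by (simp add: algebra_simps)
  qed
  define B where "B = norm (x N - of_nat N * c)"
  have "\<forall>n\<ge>max (Suc N) (nat \<lceil>2 * B / e\<rceil> + 1). norm (x n / of_nat n - c) < e"
  proof (intro allI impI)
    fix n assume n: "n \<ge> max (Suc N) (nat \<lceil>2 * B / e\<rceil> + 1)"
    have n0: "real n > 0" using n by simp
    have "2 * B / e < real n" using n by linarith
    then have B: "B < real n * (e / 2)" using e by (simp add: field_simps)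
    obtain k where k: "n = N + k" using n by (metis le_iff_add max.bounded_iff Suc_leD)
    have "norm (x n - of_nat n * c) = norm ((x (N + k) - x N - of_nat k * c) + (x N - of_nat N * c))"
      by (simp add: k algebra_simps)
    also have "\<dots> \<le> of_nat k * (e / 2) + B"
      using lin[of k] unfolding B_def by (intro norm_triangle_mono) auto
    also have "\<dots> < real n * (e / 2) + real n * (e / 2)"
      using B e k by (intro add_le_less_mono mult_right_mono) auto
    finally have *: "norm (x n - of_nat n * c) < real n * e" by (simp add: algebra_simps)
    have "x n / of_nat n - c = (x n - of_nat n * c) / of_nat n" using n0 by (simp add: field_simps)
    also have "norm \<dots> = norm (x n - of_nat n * c) / real n" by (simp add: norm_divide)
    also have "\<dots> < e" using * n0 by (simp add: field_simps)
    finally show "norm (x n / of_nat n - c) < e" .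
  qed
  then show "\<exists>no. \<forall>n\<ge>no. norm (x n / of_nat n - c) < e" by blast
qed

text \<open>A branch of log w for w = (v/z)^m. The limit z -> 0 becomes Re -> infinity, the
  direction of v has Im = 0, and the adjacent repelling directions correspond to Im = pi and Im =
  -pi.\<close>

definition log_coord :: "nat \<Rightarrow> complex \<Rightarrow> complex \<Rightarrow> complex" where
  "log_coord m v z = - of_nat m * Ln (z / v)"

lemma of_log_coord:
  assumes "v \<noteq> 0" "m \<ge> 1" "z \<noteq> 0"
  shows "v * exp (- log_coord m v z / of_nat m) = z"
  using assms by (simp add: log_coord_def)

lemma log_coord_of:
  assumes "v \<noteq> 0" "m \<ge> 1" "\<bar>Im l\<bar> < pi"
  shows "log_coord m v (v * exp (- l / of_nat m)) = l"
proof -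
  have "\<bar>Im l\<bar> / real m \<le> \<bar>Im l\<bar> / 1" using assms by (intro divide_left_mono) auto
  then have "\<bar>Im l / real m\<bar> < pi" using assms by simp
  then have "- pi < Im l / real m" "Im l / real m < pi" unfolding abs_less_iff by linarith+
  then have "Ln (exp (- l / of_nat m)) = - l / of_nat m"
    by (intro Ln_exp) (auto simp: Im_divide_of_nat)
  then show ?thesis using assms by (simp add: log_coord_def)
qed

text \<open>The attraction vector is a parameter because one argument below compares the basins of
  two neighbouring attraction vectors of the same polynomial.\<close>

locale parabolic_polynomial =
  fixes m :: nat and a v :: complex and p h :: "complex poly" and f :: "complex \<Rightarrow> complex"
  assumes m: "m \<ge> 1" and a: "a \<noteq> 0"
    and p: "p = [:0, 1:] + monom a (m + 1) + monom 1 (m + 2) * h"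
    and f: "f = poly p"
    and v: "attraction_vector m a v"
begin

abbreviation lc :: "complex \<Rightarrow> complex" where "lc \<equiv> log_coord m v"

abbreviation basin :: "complex set" where "basin \<equiv> parabolic_basin f m v"

lemma v_power: "of_nat m * a * v ^ m = -1"
  using v by (simp add: attraction_vector_def)

lemma v_nonzero: "v \<noteq> 0"
  using v_power m by (cases "v = 0") (auto simp: power_0_left)

section \<open>One step of the polynomial near \<open>0\<close>\<close>

lemma f_factor: "f z = z * (1 + (a * z ^ m + z ^ (m + 1) * poly h z))"
  by (simp add: f p poly_monom algebra_simps)

lemma f_zero [simp]: "f 0 = 0"
  by (simp add: f_factor)

lemma iterate_zero [simp]: "(f ^^ n) 0 = 0"
  by (induction n) auto

lemma iterate_holomorphic: "(f ^^ n) holomorphic_on S"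
proof (induction n arbitrary: S)
  case 0 show ?case by (simp add: id_def[symmetric] holomorphic_on_id)
next
  case (Suc n)
  have "f holomorphic_on T" for T unfolding f by (intro holomorphic_intros)
  then have "(f \<circ> (f ^^ n)) holomorphic_on S" by (intro holomorphic_on_compose Suc)
  then show ?case by (simp only: funpow.simps)
qed

lemma f_holomorphic: "f holomorphic_on S"
  using iterate_holomorphic[of 1 S] by simp

lemma iterate_continuous: "continuous_on S (f ^^ n)"
  using iterate_holomorphic holomorphic_on_imp_continuous_on by blast

text \<open>Write f z = z (1 + u) with u ~ a z^m. The change of w = (v/z)^m is w ((1 + u)^(-m) - 1)
  ~ -m u v^m / z^m, which tends to -m a v^m = 1 by the choice of v.\<close>

lemma step_limits:
  shows "((\<lambda>z. f z / z) \<longlongrightarrow> 1) (at 0)"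
    and "((\<lambda>z. (v / f z) ^ m - (v / z) ^ m) \<longlongrightarrow> 1) (at 0)"
proof -
  define u where "u = (\<lambda>z::complex. a * z ^ m + z ^ (m + 1) * poly h z)"
  define G where "G = (\<lambda>x::complex. inverse (1 + x) ^ m)"
  have "isCont u 0" unfolding u_def by (intro continuous_intros)
  moreover have "u 0 = 0" using m by (simp add: u_def)
  ultimately have u0: "(u \<longlongrightarrow> 0) (at 0)" by (metis isCont_def)
  have fu: "f z = z * (1 + u z)" for z unfolding u_def by (rule f_factor)
  have ne: "eventually (\<lambda>z::complex. z \<noteq> 0) (at 0)" by (simp add: eventually_at_filter)
  have "((\<lambda>z. 1 + u z) \<longlongrightarrow> 1 + 0) (at 0)" by (intro tendsto_intros u0)
  moreover have "eventually (\<lambda>z. 1 + u z = f z / z) (at 0)"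
    using ne by eventually_elim (simp add: fu)
  ultimately show "((\<lambda>z. f z / z) \<longlongrightarrow> 1) (at 0)"
    using Lim_transform_eventually by fastforce
  have "isCont (\<lambda>z. a + z * poly h z) 0" by (intro continuous_intros)
  then have "((\<lambda>z. a + z * poly h z) \<longlongrightarrow> a) (at 0)" by (simp add: isCont_def)
  then have ua: "((\<lambda>z. u z / z ^ m) \<longlongrightarrow> a) (at 0)"
    by (rule Lim_transform_eventually[OF _ eventually_mono[OF ne]])
      (auto simp: u_def field_simps)
  have "eventually (\<lambda>z. u z / z ^ m \<noteq> 0) (at 0)"
    using tendsto_imp_eventually_ne[OF ua a] .
  then have une: "eventually (\<lambda>z. u z \<noteq> 0) (at 0)" by eventually_elim auto
  have ufil: "filterlim u (at 0) (at 0)"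
    using u0 une by (simp add: filterlim_at)
  have "(G has_field_derivative - of_nat m) (at 0)"
    unfolding G_def using m
    by (auto intro!: derivative_eq_intros)
  then have "((\<lambda>x. (G x - 1) / x) \<longlongrightarrow> - of_nat m) (at 0)"
    by (simp add: has_field_derivative_iff G_def)
  then have Gl: "((\<lambda>z. (G (u z) - 1) / u z) \<longlongrightarrow> - of_nat m) (at 0)"
    using filterlim_compose ufil by blast
  have "((\<lambda>z. v ^ m * (u z / z ^ m) * ((G (u z) - 1) / u z)) \<longlongrightarrow> v ^ m * a * (- of_nat m)) (at 0)"
    by (intro tendsto_intros ua Gl)
  moreover have "v ^ m * a * (- of_nat m) = 1" using v_power by (simp add: algebra_simps)
  ultimately have "((\<lambda>z. v ^ m * (u z / z ^ m) * ((G (u z) - 1) / u z)) \<longlongrightarrow> 1) (at 0)" by simp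
  moreover have "eventually (\<lambda>z. v ^ m * (u z / z ^ m) * ((G (u z) - 1) / u z)
      = (v / f z) ^ m - (v / z) ^ m) (at 0)"
    using ne une
  proof eventually_elim
    case (elim z)
    have "(v / f z) ^ m = (v / z) ^ m * G (u z)"
      by (simp add: fu G_def power_mult_distrib power_divide divide_inverse power_inverse)
    then show ?case using elim by (simp add: power_divide field_simps)
  qed
  ultimately show "((\<lambda>z. (v / f z) ^ m - (v / z) ^ m) \<longlongrightarrow> 1) (at 0)"
    by (rule Lim_transform_eventually)
qed

lemma step_close:
  assumes "e > 0"
  obtains r where "r > 0" "\<And>z. \<lbrakk>z \<noteq> 0; norm z < r\<rbrakk> \<Longrightarrow>
    f z \<noteq> 0 \<and> norm (f z / z - 1) < e \<and> norm ((v / f z) ^ m - (v / z) ^ m - 1) < e"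
proof -
  have "eventually (\<lambda>z. dist (f z / z) 1 < e) (at 0)" "eventually (\<lambda>z. f z / z \<noteq> 0) (at 0)"
    "eventually (\<lambda>z. dist ((v / f z) ^ m - (v / z) ^ m) 1 < e) (at 0)"
    using step_limits assms tendsto_imp_eventually_ne[OF step_limits(1), of 0]
    by (auto intro: tendstoD)
  then have "eventually (\<lambda>z. f z \<noteq> 0 \<and> norm (f z / z - 1) < e
      \<and> norm ((v / f z) ^ m - (v / z) ^ m - 1) < e) (at 0)"
    by eventually_elim (auto simp: dist_norm)
  then show thesis using that unfolding eventually_at by (auto simp: dist_norm)
qed

lemma exp_lc: "z \<noteq> 0 \<Longrightarrow> exp (lc z) = (v / z) ^ m"
  using v_nonzero
  by (simp add: log_coord_def exp_minus exp_of_nat_mult power_divide divide_inverse power_inverse power_mult_distrib)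

lemma of_lc: "z \<noteq> 0 \<Longrightarrow> v * exp (- lc z / of_nat m) = z"
  using of_log_coord v_nonzero m by blast

lemma lc_of: "\<bar>Im l\<bar> < pi \<Longrightarrow> lc (v * exp (- l / of_nat m)) = l"
  using log_coord_of v_nonzero m by blast

text \<open>Since \<open>lc\<close> has a branch cut, a step is continued by hand:
  \<open>lc z - of_nat m * Ln (f z / z)\<close> is a candidate for the new value. The logarithm
  changes Im by at most 2 m e, and within the strip |Im| < pi the candidate must be the value of
  \<open>lc\<close>.\<close>

lemma lc_step:
  assumes "z \<noteq> 0" "f z \<noteq> 0" "norm (f z / z - 1) < e" "e \<le> 1/2" "\<bar>Im (lc z)\<bar> + 2 * of_nat m * e < pi"
  shows "\<bar>Im (lc (f z))\<bar> < pi"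
proof -
  define l where "l = lc z - of_nat m * Ln (f z / z)"
  have "norm (Ln (1 + (f z / z - 1))) \<le> 2 * norm (f z / z - 1)"
    using assms by (intro norm_Ln_le) auto
  then have "norm (Ln (f z / z)) \<le> 2 * e" using assms by simp
  then have "\<bar>Im (Ln (f z / z))\<bar> \<le> 2 * e" by (meson abs_Im_le_cmod order_trans)
  then have "real m * \<bar>Im (Ln (f z / z))\<bar> \<le> real m * (2 * e)" by (intro mult_left_mono) auto
  then have "\<bar>real m * Im (Ln (f z / z))\<bar> \<le> 2 * real m * e" by (simp add: abs_mult algebra_simps)
  then have il: "\<bar>Im l\<bar> < pi" using assms(5) unfolding l_def by auto
  have "v * exp (- l / of_nat m) = v * exp (- lc z / of_nat m) * exp (Ln (f z / z))"
    using m by (simp add: l_def exp_add[symmetric] field_simps)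
  also have "\<dots> = f z" using assms of_lc by simp
  finally show ?thesis using lc_of[OF il] il by simp
qed

lemma norm_via_lc:
  assumes "z \<noteq> 0" "r > 0" "norm (exp (lc z)) > (norm v / r) ^ m"
  shows "norm z < r"
proof -
  have "(norm v / r) ^ m < (norm v / norm z) ^ m"
    using assms exp_lc[of z] by (simp add: norm_power norm_divide)
  then have "norm v / r < norm v / norm z" by (rule power_less_imp_less_base) auto
  then show ?thesis using assms v_nonzero by (simp add: field_simps)
qed

lemma norm_of: "norm (v * exp (- l / of_nat m)) = norm v * exp (- Re l / of_nat m)"
  by (simp add: norm_mult)

text \<open>The increments of w tend to 1, so w_n / n -> 1. The strip condition makes
  \<open>lc\<close> the principal logarithm of w_n; this selects v among the m candidates for the
  limit of n^(1/m) z_n.\<close>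

lemma basin_via_lc:
  assumes nz: "\<And>n. (f ^^ n) z \<noteq> 0" and lim: "(\<lambda>n. (f ^^ n) z) \<longlonglongrightarrow> 0"
    and im: "\<And>n. \<bar>Im (lc ((f ^^ n) z))\<bar> < pi"
  shows "z \<in> basin"
proof -
  define w where "w = (\<lambda>n. exp (lc ((f ^^ n) z)))"
  have "filterlim (\<lambda>n. (f ^^ n) z) (at 0) sequentially" using lim nz by (simp add: filterlim_at)
  from filterlim_compose[OF step_limits(2) this]
  have "(\<lambda>n. w (Suc n) - w n) \<longlonglongrightarrow> 1" unfolding w_def using nz
    by (simp add: exp_lc nz[of "Suc _", simplified])
  then have "(\<lambda>n. w n / of_nat n) \<longlonglongrightarrow> 1" by (rule tendsto_divide_nat_of_increments)
  then have "(\<lambda>n. Ln (w n / of_nat n)) \<longlonglongrightarrow> Ln 1"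
    by (intro tendsto_Ln) auto
  moreover have "isCont (\<lambda>x. v * exp (- x / of_nat m)) (Ln 1)" using m by (intro continuous_intros) auto
  ultimately have "(\<lambda>n. v * exp (- (Ln (w n / of_nat n)) / of_nat m)) \<longlonglongrightarrow> v * exp (- Ln 1 / of_nat m)"
    by (rule isCont_tendsto_compose[rotated])
  then have *: "(\<lambda>n. v * exp (- (Ln (w n / of_nat n)) / of_nat m)) \<longlonglongrightarrow> v" by simp
  have "eventually (\<lambda>n. v * exp (- (Ln (w n / of_nat n)) / of_nat m)
      = complex_of_real (root m (real n)) * (f ^^ n) z) sequentially"
    using eventually_gt_at_top[of 0]
  proof eventually_elim
    case (elim n)
    have "Ln (w n / of_nat n) = Ln (of_real (1 / real n) * w n)" by simp
    also have "\<dots> = of_real (ln (1 / real n)) + Ln (w n)"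
      using elim Ln_times_of_real[of "1 / real n" "w n"] Ln_of_real[of "1 / real n"]
      by (simp add: w_def del: of_real_divide)
    also have "Ln (w n) = lc ((f ^^ n) z)"
      unfolding w_def using im[of n] by (intro Ln_exp) auto
    finally have eq: "lc ((f ^^ n) z) = of_real (ln (real n)) + Ln (w n / of_nat n)"
      using elim by (simp add: ln_div)
    have "- (Ln (w n / of_nat n)) / of_nat m
        = of_real (ln (real n) / real m) + (- lc ((f ^^ n) z) / of_nat m)"
      unfolding eq by (simp add: add_divide_distrib diff_divide_distrib)
    then have "v * exp (- (Ln (w n / of_nat n)) / of_nat m)
        = exp (of_real (ln (real n) / real m)) * (v * exp (- lc ((f ^^ n) z) / of_nat m))"
      by (simp only: exp_add) (simp add: mult_ac)
    also have "\<dots> = exp (of_real (ln (real n) / real m)) * (f ^^ n) z" using of_lc nz by simp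
    also have "exp (complex_of_real (ln (real n) / real m)) = of_real (root m (real n))"
      using elim m by (simp only: exp_of_real) (simp add: root_powr_inverse powr_def)
    finally show ?case .
  qed
  from Lim_transform_eventually[OF * this] show ?thesis
    using nz lim by (simp add: parabolic_basin_def converges_from_direction_def)
qed

end

section \<open>Sectors in the basin\<close>

text \<open>The functional \<open>\<lambda>w. \<bar>Im w\<bar> + k * Re w\<close> is positive exactly on a sector around the positive
  real axis, and maps close to \<open>w \<mapsto> w + 1\<close> increase it.\<close>

lemma weight_step:
  assumes "norm (w' - w - 1) < e" "e \<le> k / 4" "0 < k" "k \<le> (1::real)"
  shows "\<bar>Im w'\<bar> + k * Re w' \<ge> \<bar>Im w\<bar> + k * Re w + k / 2"
proof -
  have 1: "\<bar>Im (w' - w - 1)\<bar> < e" "\<bar>Re (w' - w - 1)\<bar> < e"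
    using assms(1) le_less_trans[OF abs_Im_le_cmod] le_less_trans[OF abs_Re_le_cmod] by blast+
  then have "k * \<bar>Re (w' - w - 1)\<bar> \<le> 1 * e" using assms by (intro mult_mono) auto
  then have "k * (- Re (w' - w - 1)) \<le> e"
    using assms by (smt (verit) mult_left_mono)
  then have "k * Re w' \<ge> k * Re w + k - e" by (simp add: algebra_simps)
  moreover have "\<bar>Im w'\<bar> \<ge> \<bar>Im w\<bar> - e" using 1 by auto
  ultimately show ?thesis using assms by linarith
qed

lemma weight_le_norm:
  assumes "0 < k" "k \<le> (1::real)"
  shows "\<bar>Im w\<bar> + k * Re w \<le> 2 * norm w"
proof -
  have "k * Re w \<le> k * \<bar>Re w\<bar>" using assms by (intro mult_left_mono) auto
  moreover have "k * \<bar>Re w\<bar> \<le> 1 * norm w"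
    using assms by (intro mult_mono) (auto simp: abs_Re_le_cmod)
  ultimately have "k * Re w \<le> norm w" by linarith
  then show ?thesis using abs_Im_le_cmod[of w] by linarith
qed

text \<open>Let x be the distance of |arg w| to pi. If x <= k/2, then cos x >= 1/2 and sin x <= k/2,
  so the weight |w| (sin x - k cos x) cannot be positive. The gap k/2 is what one step may consume
  without reaching the cut.\<close>

lemma angle_of_weight:
  assumes "\<bar>Im l\<bar> < pi" "\<bar>Im (exp l)\<bar> + k * Re (exp l) > 0" "0 < k" "k \<le> 1"
  shows "\<bar>Im l\<bar> < pi - k / 2"
proof (rule ccontr)
  assume not: "\<not> ?thesis"
  define x where "x = pi - \<bar>Im l\<bar>"
  have x: "0 < x" "x \<le> k / 2" using not assms by (auto simp: x_def)
  have "x \<le> pi / 3" using x assms pi_ge_two by linarith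
  then have "cos x \<ge> cos (pi / 3)" using x by (intro cos_monotone_0_pi_le) auto
  then have c: "cos x \<ge> 1 / 2" by (simp add: cos_60)
  have s: "sin x \<le> k / 2" using sin_x_le_x[of x] x by linarith
  have s0: "sin x \<ge> 0" using x assms by (intro sin_ge_zero) (auto simp: x_def)
  have im: "\<bar>sin (Im l)\<bar> = sin x"
    using s0 by (cases "Im l \<ge> 0") (auto simp: x_def sin_diff cos_diff)
  have re: "cos (Im l) = - cos x"
    by (cases "Im l \<ge> 0") (auto simp: x_def sin_diff cos_diff)
  have "\<bar>Im (exp l)\<bar> + k * Re (exp l) = exp (Re l) * (sin x - k * cos x)"
    by (simp add: Im_exp Re_exp abs_mult im re algebra_simps)
  moreover have "k * cos x \<ge> k * (1 / 2)" using c assms by (intro mult_left_mono) auto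
  then have "exp (Re l) * (sin x - k * cos x) \<le> 0"
    using s by (intro mult_nonneg_nonpos) auto
  ultimately show False using assms by linarith
qed

text \<open>For cos t >= 0 use sin t + cos t >= 1; otherwise sin t >= sin b = 2 * k outweighs the
  loss of at most k.\<close>

lemma weight_of_angle:
  assumes "\<bar>Im l\<bar> \<le> pi - b" "0 < b" "b \<le> pi / 2" "k = sin b / 2"
  shows "\<bar>Im (exp l)\<bar> + k * Re (exp l) \<ge> exp (Re l) * k"
proof -
  define t where "t = \<bar>Im l\<bar>"
  have t: "0 \<le> t" "t \<le> pi - b" "t \<le> pi" using assms by (auto simp: t_def)
  have s0: "sin t \<ge> 0" using t by (intro sin_ge_zero) auto
  have "0 < sin b" using assms pi_gt_zero by (intro sin_gt_zero) linarith+
  then have k: "0 < k" "k \<le> 1" using assms(4) sin_le_one[of b] by linarith+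
  have im: "\<bar>sin (Im l)\<bar> = sin t" using s0 by (auto simp: t_def abs_if split: if_splits)
  have re: "cos (Im l) = cos t" by (auto simp: t_def abs_if)
  have "sin t + k * cos t \<ge> k"
  proof (cases "cos t \<ge> 0")
    case True
    have "sin t * sin t \<le> sin t * 1" "cos t * cos t \<le> cos t * 1"
      using True s0 by (intro mult_left_mono; simp)+
    then have "sin t + cos t \<ge> 1" using sin_cos_squared_add3[of t] by linarith
    then have "k * (sin t + cos t) \<ge> k * 1" using k by (intro mult_left_mono) auto
    moreover have "k * sin t \<le> 1 * sin t" using k s0 by (intro mult_right_mono) auto
    ultimately show ?thesis by (simp add: algebra_simps)
  next
    case False
    then have "t > pi / 2" using t cos_ge_zero[of t] by force
    then have "sin b \<le> sin (pi - t)" using t assms by (intro sin_monotone_2pi_le) auto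
    then have "sin t \<ge> 2 * k" using assms by simp
    moreover have "k * cos t \<ge> k * (- 1)" using k by (intro mult_left_mono) auto
    ultimately show ?thesis by simp
  qed
  then have "exp (Re l) * (sin t + k * cos t) \<ge> exp (Re l) * k" by (intro mult_left_mono) auto
  then show ?thesis by (simp add: Im_exp Re_exp abs_mult im re algebra_simps)
qed

section \<open>Orbits that start in a sector, and orbits of the basin near \<open>0\<close>\<close>

context parabolic_polynomial
begin

text \<open>Three facts feed one another in the induction: a large weight makes |w| large and z
  small, a small z makes the step close to w + 1, and such a step increases the weight by k/2 and
  does not reach the cut.\<close>

lemma sector_orbit:
  assumes "r > 0" "0 < k" "k \<le> (1::real)"
  obtains R where "R > 0"
    "\<And>z. \<lbrakk>z \<noteq> 0; \<bar>Im (lc z)\<bar> < pi; \<bar>Im (exp (lc z))\<bar> + k * Re (exp (lc z)) > R\<rbrakk>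
      \<Longrightarrow> z \<in> basin \<and> (\<forall>n. norm ((f ^^ n) z) < r)"
proof -
  \<comment> \<open>With this e the allowance 2 m e of \<open>lc_step\<close> is exactly the gap k/2
    of \<open>angle_of_weight\<close>, and e <= k/4 as \<open>weight_step\<close> demands.\<close>
  define e where "e = k / (4 * real m)"
  have e: "e > 0" using assms m by (simp add: e_def)
  have "k / (4 * real m) \<le> k / 4" using assms m by (intro divide_left_mono) auto
  then have e4: "e \<le> k / 4" by (simp add: e_def)
  have em: "2 * of_nat m * e = k / 2" using m by (simp add: e_def)
  obtain r0 where r0: "r0 > 0" "\<And>z. \<lbrakk>z \<noteq> 0; norm z < r0\<rbrakk> \<Longrightarrow>
    f z \<noteq> 0 \<and> norm (f z / z - 1) < e \<and> norm ((v / f z) ^ m - (v / z) ^ m - 1) < e"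
    using step_close[OF e] by blast
  define W where "W = (\<lambda>z. \<bar>Im (exp (lc z))\<bar> + k * Re (exp (lc z)))"
  have small: "norm z < s" if "z \<noteq> 0" "s > 0" "W z > 2 * (norm v / s) ^ m" for z s
  proof (rule norm_via_lc)
    show "norm (exp (lc z)) > (norm v / s) ^ m"
      using weight_le_norm[OF assms(2,3), of "exp (lc z)"] that unfolding W_def by linarith
  qed (use that in auto)
  define s where "s = min r r0"
  have s: "s > 0" using assms r0 by (simp add: s_def)
  \<comment> \<open>The weight is at most 2 |w|, so a weight above this R forces |z| < s.\<close>
  define R where "R = 2 * (norm v / s) ^ m"
  have R: "R > 0" using s v_nonzero by (simp add: R_def)
  show thesis
  proof (rule that[OF R])
    fix z assume z: "z \<noteq> 0" "\<bar>Im (lc z)\<bar> < pi" "\<bar>Im (exp (lc z))\<bar> + k * Re (exp (lc z)) > R"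
    have inv: "(f ^^ n) z \<noteq> 0 \<and> \<bar>Im (lc ((f ^^ n) z))\<bar> < pi \<and> W ((f ^^ n) z) \<ge> W z + real n * (k / 2)" for n
    proof (induction n)
      case 0 show ?case using z by simp
    next
      case (Suc n)
      define y where "y = (f ^^ n) z"
      have y: "y \<noteq> 0" "\<bar>Im (lc y)\<bar> < pi" "W y \<ge> W z + real n * (k / 2)"
        using Suc by (auto simp: y_def)
      have "real n * (k / 2) \<ge> 0" using assms by simp
      then have WR: "W y > R" using y(3) z(3) unfolding W_def by linarith
      then have "norm y < s" using small[of y s] y s by (simp add: R_def)
      then have fy: "f y \<noteq> 0" "norm (f y / y - 1) < e" "norm ((v / f y) ^ m - (v / y) ^ m - 1) < e"
        using r0(2)[of y] y by (auto simp: s_def)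
      have "\<bar>Im (lc y)\<bar> < pi - k / 2"
        using angle_of_weight[of "lc y" k] y WR R assms unfolding W_def by linarith
      then have "\<bar>Im (lc (f y))\<bar> < pi"
        using fy y e4 assms em by (intro lc_step[of y e]) auto
      moreover have "W (f y) \<ge> W y + k / 2"
        unfolding W_def using fy y e4 assms by (intro weight_step[of _ _ e]) (auto simp: exp_lc)
      moreover have "real (Suc n) * (k / 2) = real n * (k / 2) + k / 2" by (simp add: field_simps)
      ultimately have "\<bar>Im (lc (f y))\<bar> < pi" "W (f y) \<ge> W z + real (Suc n) * (k / 2)"
        using y(3) by linarith+
      then show ?case using fy(1) by (simp add: y_def)
    qed
    have "W ((f ^^ n) z) > R" for n
    proof -
      have "real n * (k / 2) \<ge> 0" using assms by simp
      then show ?thesis using inv[of n] z(3) unfolding W_def by linarith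
    qed
    then have bd: "norm ((f ^^ n) z) < s" for n using small inv s by (simp add: R_def)
    have "(\<lambda>n. (f ^^ n) z) \<longlonglongrightarrow> 0"
    proof (rule LIMSEQ_I)
      fix t :: real assume t: "t > 0"
      obtain N :: nat where N: "real N > (2 * (norm v / t) ^ m - W z) / (k / 2)"
        using reals_Archimedean2 by blast
      have "norm ((f ^^ n) z) < t" if "n \<ge> N" for n
      proof -
        have "real n > (2 * (norm v / t) ^ m - W z) / (k / 2)" using that N by linarith
        then have "real n * (k / 2) > 2 * (norm v / t) ^ m - W z"
          using assms by (subst (asm) pos_divide_less_eq) auto
        then have "W ((f ^^ n) z) > 2 * (norm v / t) ^ m" using inv[of n] by linarith
        then show ?thesis using small[of "(f ^^ n) z" t] inv t by blast
      qed
      then show "\<exists>no. \<forall>n\<ge>no. norm ((f ^^ n) z - 0) < t" by auto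
    qed
    then have "z \<in> basin" using inv by (intro basin_via_lc) auto
    then show "z \<in> basin \<and> (\<forall>n. norm ((f ^^ n) z) < r)" using bd by (auto simp: s_def)
  qed
qed

lemma sector_basin:
  assumes "r > 0" "0 < b" "b \<le> pi / 2"
  obtains X where
    "\<And>z. \<lbrakk>z \<noteq> 0; \<bar>Im (lc z)\<bar> \<le> pi - b; Re (lc z) \<ge> X\<rbrakk>
      \<Longrightarrow> z \<in> basin \<and> (\<forall>n. norm ((f ^^ n) z) < r)"
proof -
  define k where "k = sin b / 2"
  have "0 < sin b" using assms pi_gt_zero by (intro sin_gt_zero) linarith+
  then have k: "0 < k" "k \<le> 1" using k_def sin_le_one[of b] by linarith+
  obtain R where R: "R > 0"
    "\<And>z. \<lbrakk>z \<noteq> 0; \<bar>Im (lc z)\<bar> < pi; \<bar>Im (exp (lc z))\<bar> + k * Re (exp (lc z)) > R\<rbrakk>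
      \<Longrightarrow> z \<in> basin \<and> (\<forall>n. norm ((f ^^ n) z) < r)"
    using sector_orbit[OF assms(1) k] by blast
  show thesis
  proof (rule that[of "ln ((R + 1) / k)"])
    fix z assume z: "z \<noteq> 0" "\<bar>Im (lc z)\<bar> \<le> pi - b" "Re (lc z) \<ge> ln ((R + 1) / k)"
    have "exp (Re (lc z)) \<ge> exp (ln ((R + 1) / k))" using z by simp
    then have "exp (Re (lc z)) * k \<ge> R + 1" using R k by (simp add: field_simps)
    then have "\<bar>Im (exp (lc z))\<bar> + k * Re (exp (lc z)) > R"
      using weight_of_angle[OF z(2) assms(2,3) k_def] by linarith
    then show "z \<in> basin \<and> (\<forall>n. norm ((f ^^ n) z) < r)"
      using R(2)[of z] z assms by auto
  qed
qed

text \<open>The convergence n^(1/m) z_n -> v says that lc z_n = ln n + o(1), so the orbit approaches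
  the axis Im = 0 while Re runs to infinity.\<close>

lemma basin_orbit_tangential:
  assumes "z \<in> basin"
  shows "eventually (\<lambda>n. \<bar>Im (lc ((f ^^ n) z))\<bar> < pi / 2 \<and> Re (lc ((f ^^ n) z)) > X) sequentially"
proof -
  have lim: "(\<lambda>k. complex_of_real (root m (real k)) * (f ^^ k) z) \<longlonglongrightarrow> v"
    and nz: "\<And>n. (f ^^ n) z \<noteq> 0"
    using assms by (auto simp: parabolic_basin_def converges_from_direction_def)
  define u where "u = (\<lambda>n. complex_of_real (root m (real n)) * (f ^^ n) z / v)"
  have "u \<longlonglongrightarrow> v / v" unfolding u_def using lim v_nonzero by (intro tendsto_intros) auto
  then have "(\<lambda>n. Ln (u n)) \<longlonglongrightarrow> Ln 1" using v_nonzero by (intro tendsto_Ln) auto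
  then have "(\<lambda>n. - of_nat m * Ln (u n)) \<longlonglongrightarrow> - of_nat m * Ln 1" by (rule tendsto_mult_left)
  then have l: "(\<lambda>n. - of_nat m * Ln (u n)) \<longlonglongrightarrow> 0" by simp
  have "eventually (\<lambda>n. norm (- of_nat m * Ln (u n)) < 1) sequentially"
    using tendstoD[OF l, of 1] by simp
  moreover have "eventually (\<lambda>n. ln (real n) > X + 1) sequentially"
    using filterlim_compose[OF ln_at_top filterlim_real_sequentially]
    by (simp add: filterlim_at_top_dense)
  ultimately show ?thesis using eventually_gt_at_top[of 0]
  proof eventually_elim
    case (elim n)
    have "Ln (u n) = Ln (of_real (root m (real n)) * ((f ^^ n) z / v))" by (simp add: u_def)
    also have "\<dots> = of_real (ln (root m (real n))) + Ln ((f ^^ n) z / v)"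
      using elim m nz v_nonzero Ln_times_of_real[of "root m (real n)" "(f ^^ n) z / v"]
        Ln_of_real[of "root m (real n)"] by simp
    also have "ln (root m (real n)) = ln (real n) / real m" using elim m by (simp add: ln_root)
    finally have "lc ((f ^^ n) z) = of_real (ln (real n)) + (- of_nat m * Ln (u n))"
      using m by (simp add: log_coord_def field_simps)
    moreover have "\<bar>Im (- of_nat m * Ln (u n))\<bar> < 1" "\<bar>Re (- of_nat m * Ln (u n))\<bar> < 1"
      using elim by (meson abs_Im_le_cmod abs_Re_le_cmod le_less_trans)+
    ultimately show ?case using elim pi_ge_two by (simp del: mult_minus_left)
  qed
qed

text \<open>\<open>lc\<close> is discontinuous across its cut, but since m >= 1 the condition on Im
  keeps z / v in the right half-plane, where \<open>lc\<close> is continuous.\<close>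

lemma open_attracting_sector:
  "open {z. z \<noteq> 0 \<and> \<bar>Im (lc z)\<bar> < pi / 2 \<and> Re (lc z) > X}" (is "open ?U")
proof -
  define H where "H = {z. Re (z / v) > 0}"
  have oH: "open H" unfolding H_def using v_nonzero
    by (intro open_Collect_less continuous_intros) auto
  have cont: "continuous_on H lc"
    unfolding log_coord_def H_def using v_nonzero
    by (intro continuous_intros) (auto simp: complex_nonpos_Reals_iff)
  have "z \<in> H" if "z \<noteq> 0" "\<bar>Im (lc z)\<bar> < pi / 2" for z
  proof -
    have "\<bar>Im (Ln (z / v))\<bar> * 1 \<le> \<bar>Im (Ln (z / v))\<bar> * real m"
      using m by (intro mult_left_mono) auto
    then have "\<bar>Im (Ln (z / v))\<bar> < pi / 2"
      using that by (simp add: log_coord_def abs_mult mult.commute)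
    then show ?thesis using that v_nonzero Re_Ln_pos_lt[of "z / v"] by (simp add: H_def)
  qed
  moreover have "0 \<notin> H" by (simp add: H_def)
  ultimately have "?U = H \<inter> lc -` {l. \<bar>Im l\<bar> < pi / 2 \<and> Re l > X}" by auto
  moreover have "open {l. \<bar>Im l\<bar> < pi / 2 \<and> Re l > X}"
    by (intro open_Collect_conj open_Collect_less continuous_intros)
  ultimately show ?thesis using continuous_open_preimage[OF cont oH] by (simp only:)
qed

text \<open>Every orbit of the basin enters an open sector whose orbits never leave the disc of
  radius r. Finitely many preimages of this sector cover K, and the largest exponent serves as
  N.\<close>

lemma basin_uniform:
  assumes K: "compact K" "K \<subseteq> basin" and r: "r > 0"
  obtains N where "\<And>n z. \<lbrakk>n \<ge> N; z \<in> K\<rbrakk> \<Longrightarrow> norm ((f ^^ n) z) < r"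
proof -
  obtain X where X: "\<And>z. \<lbrakk>z \<noteq> 0; \<bar>Im (lc z)\<bar> \<le> pi - pi / 2; Re (lc z) \<ge> X\<rbrakk>
      \<Longrightarrow> z \<in> basin \<and> (\<forall>n. norm ((f ^^ n) z) < r)"
    using sector_basin[OF r, of "pi / 2"] by auto
  define U where "U = {z. z \<noteq> 0 \<and> \<bar>Im (lc z)\<bar> < pi / 2 \<and> Re (lc z) > X}"
  have oU: "open ((f ^^ n) -` U)" for n
    unfolding U_def by (intro open_vimage open_attracting_sector iterate_continuous)
  have cover: "z \<in> (\<Union>n. (f ^^ n) -` U)" if "z \<in> K" for z
  proof -
    have z: "z \<in> basin" using that K by auto
    then have "(f ^^ n) z \<noteq> 0" for n
      by (simp add: parabolic_basin_def converges_from_direction_def)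
    moreover obtain n where "\<bar>Im (lc ((f ^^ n) z))\<bar> < pi / 2 \<and> Re (lc ((f ^^ n) z)) > X"
      using basin_orbit_tangential[OF z, of X] unfolding eventually_sequentially by blast
    ultimately have "(f ^^ n) z \<in> U" unfolding U_def by blast
    then show ?thesis by blast
  qed
  obtain I :: "nat set" where I: "finite I" "K \<subseteq> (\<Union>n\<in>I. (f ^^ n) -` U)"
  proof (rule compactE_image[OF K(1), of UNIV "\<lambda>n. (f ^^ n) -` U"])
    show "open ((f ^^ n) -` U)" for n by (rule oU)
    show "K \<subseteq> (\<Union>n. (f ^^ n) -` U)" using cover by blast
  qed
  show thesis
  proof (rule that[of "Max (insert 0 I)"])
    fix n z assume n: "n \<ge> Max (insert 0 I)" and z: "z \<in> K"
    obtain i where i: "i \<in> I" "(f ^^ i) z \<in> U" using I z by auto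
    have "i \<le> n" using i n I by simp
    then have "(f ^^ n) z = (f ^^ (n - i)) ((f ^^ i) z)"
      by (metis funpow_add comp_apply le_add_diff_inverse2)
    moreover have "\<forall>n. norm ((f ^^ n) ((f ^^ i) z)) < r"
      using X[of "(f ^^ i) z"] i(2) unfolding U_def by simp
    ultimately show "norm ((f ^^ n) z) < r" by metis
  qed
qed

end

section \<open>The Kobayashi metric\<close>

text \<open>A real infimum over the empty set carries no information, so estimates need a
  competitor. An affine disc inside a ball around z provides one for every direction.\<close>

lemma kobayashi_metric_nonempty:
  assumes "open \<Omega>" "z \<in> \<Omega>"
  shows "{r. r > 0 \<and> (\<exists>g. g holomorphic_on ball 0 1 \<and> g ` ball 0 1 \<subseteq> \<Omega> \<and>
                          g 0 = z \<and> complex_of_real r * deriv g 0 = \<xi>)} \<noteq> {}"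
proof -
  obtain e where e: "e > 0" "ball z e \<subseteq> \<Omega>" using assms openE by blast
  obtain r u where r: "r > 0" "complex_of_real r * u = \<xi>" and nu: "norm u \<le> e"
  proof (cases "\<xi> = 0")
    case True
    then show ?thesis using that[of 1 0] e by simp
  next
    case False
    show ?thesis
    proof (rule that)
      show "norm \<xi> / e > 0" using False e by simp
      show "complex_of_real (norm \<xi> / e) * (\<xi> * of_real e / of_real (norm \<xi>)) = \<xi>"
        using False e by (simp add: field_simps)
      show "norm (\<xi> * of_real e / of_real (norm \<xi>)) \<le> e"
        using False e by (simp add: norm_mult norm_divide)
    qed
  qed
  define g where "g = (\<lambda>s. z + s * u)"
  have "(g has_field_derivative u) (at 0)" unfolding g_def by (auto intro!: derivative_eq_intros)
  then have "deriv g 0 = u" by (rule DERIV_imp_deriv)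
  moreover have "g holomorphic_on ball 0 1" unfolding g_def by (intro holomorphic_intros)
  moreover have "g ` ball 0 1 \<subseteq> \<Omega>"
  proof -
    have "g s \<in> ball z e" if "norm s < 1" for s
    proof -
      have "norm s * norm u \<le> norm s * e" using nu by (intro mult_left_mono) auto
      also have "\<dots> < 1 * e" using that e by (intro mult_strict_right_mono) auto
      finally show ?thesis by (simp add: g_def dist_norm norm_mult)
    qed
    then show ?thesis using e by auto
  qed
  moreover have "g 0 = z" by (simp add: g_def)
  ultimately show ?thesis using r by blast
qed

text \<open>Composition with F turns a competing disc in the source into one in the target with the
  same r, so the infimum on the target side runs over a larger set.\<close>

lemma kobayashi_metric_image_le:
  assumes \<Omega>: "open \<Omega>" "z \<in> \<Omega>" and F: "F holomorphic_on \<Omega>" "F ` \<Omega> \<subseteq> \<Omega>'"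
  shows "kobayashi_metric \<Omega>' (F z) (deriv F z * \<xi>) \<le> kobayashi_metric \<Omega> z \<xi>"
  unfolding kobayashi_metric_def
proof (rule cInf_superset_mono[OF kobayashi_metric_nonempty[OF \<Omega>]])
  show "bdd_below {r. r > 0 \<and> (\<exists>g. g holomorphic_on ball 0 1 \<and> g ` ball 0 1 \<subseteq> \<Omega>' \<and>
                          g 0 = F z \<and> complex_of_real r * deriv g 0 = deriv F z * \<xi>)}"
    by (rule bdd_belowI[of _ 0]) auto
  show "{r. r > 0 \<and> (\<exists>g. g holomorphic_on ball 0 1 \<and> g ` ball 0 1 \<subseteq> \<Omega> \<and>
                          g 0 = z \<and> complex_of_real r * deriv g 0 = \<xi>)}
      \<subseteq> {r. r > 0 \<and> (\<exists>g. g holomorphic_on ball 0 1 \<and> g ` ball 0 1 \<subseteq> \<Omega>' \<and>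
                          g 0 = F z \<and> complex_of_real r * deriv g 0 = deriv F z * \<xi>)}"
  proof safe
    fix r :: real and g
    assume r: "0 < r" and g: "g holomorphic_on ball 0 1" "g ` ball 0 1 \<subseteq> \<Omega>"
    assume z: "z = g 0"
    have "(g has_field_derivative deriv g 0) (at 0)"
      using g by (intro holomorphic_derivI[of _ "ball 0 1"]) auto
    moreover have "(F has_field_derivative deriv F (g 0)) (at (g 0))"
      using \<Omega> F z by (intro holomorphic_derivI[of _ \<Omega>]) auto
    ultimately have "((F \<circ> g) has_field_derivative deriv F (g 0) * deriv g 0) (at 0)"
      by (rule DERIV_chain[rotated])
    then have "deriv (F \<circ> g) 0 = deriv F (g 0) * deriv g 0" by (rule DERIV_imp_deriv)
    moreover have "(F \<circ> g) holomorphic_on ball 0 1"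
      using g F holomorphic_on_compose_gen by blast
    moreover have "(F \<circ> g) ` ball 0 1 \<subseteq> \<Omega>'" using g F by auto
    ultimately show "\<exists>ga. ga holomorphic_on ball 0 1 \<and> ga ` ball 0 1 \<subseteq> \<Omega>' \<and> ga 0 = F (g 0)
        \<and> complex_of_real r * deriv ga 0 = deriv F (g 0) * (complex_of_real r * deriv g 0)"
      by (intro exI[of _ "F \<circ> g"]) auto
  qed
qed

section \<open>Lengths and distances, with estimates from above and below\<close>

lemma valid_path_regular:
  assumes "valid_path \<gamma>"
  obtains S where "finite S" "\<And>t. t \<in> {0..1} - S \<Longrightarrow> \<gamma> differentiable at t"
    "continuous_on ({0..1} - S) (\<lambda>t. vector_derivative \<gamma> (at t))"
proof -
  obtain S where "finite S" "\<gamma> C1_differentiable_on ({0..1} - S)"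
    using assms unfolding valid_path_def piecewise_C1_differentiable_on_def by auto
  then show thesis using that[of S] unfolding C1_differentiable_on_eq by simp
qed

lemma kobayashi_length_image_le:
  assumes \<Omega>: "open \<Omega>" and F: "F holomorphic_on \<Omega>" "F ` \<Omega> \<subseteq> \<Omega>'"
    and \<gamma>: "valid_path \<gamma>" "path_image \<gamma> \<subseteq> \<Omega>"
  shows "kobayashi_length \<Omega>' (F \<circ> \<gamma>) \<le> kobayashi_length \<Omega> \<gamma>"
proof -
  obtain S where S: "finite S" "\<And>t. t \<in> {0..1} - S \<Longrightarrow> \<gamma> differentiable at t"
    using valid_path_regular[OF \<gamma>(1)] by metis
  have "AE t in lborel. t \<notin> S"
    using S(1) by (intro AE_not_in) (auto intro: finite_imp_null_set_lborel)
  then show ?thesis unfolding kobayashi_length_def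
  proof (intro nn_integral_mono_AE, eventually_elim)
    case (elim t)
    show ?case
    proof (cases "t \<in> {0..1}")
      case True
      then have g: "\<gamma> t \<in> \<Omega>" using \<gamma>(2) by (auto simp: path_image_def)
      have "vector_derivative (F \<circ> \<gamma>) (at t) = vector_derivative \<gamma> (at t) * deriv F (\<gamma> t)"
        using S True elim g \<Omega> F
        by (intro vector_derivative_chain_at_general) (auto intro: holomorphic_on_imp_differentiable_at)
      then show ?thesis
        using kobayashi_metric_image_le[OF \<Omega> g F, of "vector_derivative \<gamma> (at t)"] True
        by (simp add: mult.commute ennreal_leI)
    qed simp
  qed
qed

lemma kobayashi_dist_image_le:
  assumes "open \<Omega>" "F holomorphic_on \<Omega>" "F ` \<Omega> \<subseteq> \<Omega>'"
  shows "kobayashi_dist \<Omega>' (F z) (F w) \<le> kobayashi_dist \<Omega> z w"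
  unfolding kobayashi_dist_def
proof (rule Inf_mono)
  fix x assume "x \<in> {kobayashi_length \<Omega> \<gamma> |\<gamma>. valid_path \<gamma> \<and> path_image \<gamma> \<subseteq> \<Omega> \<and>
                                     pathstart \<gamma> = z \<and> pathfinish \<gamma> = w}"
  then obtain \<gamma> where \<gamma>: "x = kobayashi_length \<Omega> \<gamma>" "valid_path \<gamma>" "path_image \<gamma> \<subseteq> \<Omega>"
    "pathstart \<gamma> = z" "pathfinish \<gamma> = w" by blast
  have "valid_path (F \<circ> \<gamma>)" using \<gamma> assms valid_path_compose_holomorphic by blast
  moreover have "path_image (F \<circ> \<gamma>) \<subseteq> \<Omega>'" using \<gamma> assms by (auto simp: path_image_compose)
  ultimately have "kobayashi_length \<Omega>' (F \<circ> \<gamma>) \<in> {kobayashi_length \<Omega>' \<gamma> |\<gamma>. valid_path \<gamma> \<and>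
      path_image \<gamma> \<subseteq> \<Omega>' \<and> pathstart \<gamma> = F z \<and> pathfinish \<gamma> = F w}"
    using \<gamma> by (auto simp: pathstart_compose pathfinish_compose)
  then show "\<exists>a\<in>{kobayashi_length \<Omega>' \<gamma> |\<gamma>. valid_path \<gamma> \<and>
      path_image \<gamma> \<subseteq> \<Omega>' \<and> pathstart \<gamma> = F z \<and> pathfinish \<gamma> = F w}. a \<le> x"
    using kobayashi_length_image_le[OF assms \<gamma>(2,3)] \<gamma>(1) by blast
qed

text \<open>Normalise the omitted values b, c to 0, 1. Schottky's theorem bounds every competing
  disc near its centre, and Cauchy's inequality then bounds its derivative by a multiple of |c -
  b|.\<close>

lemma kobayashi_metric_two_omitted:
  obtains M where "M > 0" "\<And>\<Omega> z \<xi> b c. \<lbrakk>open \<Omega>; z \<in> \<Omega>; b \<notin> \<Omega>; c \<notin> \<Omega>; b \<noteq> c; norm (z - b) \<le> 4 * norm (c - b)\<rbrakk>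
    \<Longrightarrow> norm \<xi> \<le> M * norm (c - b) * kobayashi_metric \<Omega> z \<xi>"
proof -
  \<comment> \<open>Schottky's bound on radius 1/2 for a function with |G 0| <= 4; the 4 comes from
    the hypothesis on |z - b|.\<close>
  define B where "B = exp (pi * exp (pi * (2 + 2 * 4 + 12 * (1/2) / (1 - 1/2))))"
  have B: "B > 0" by (simp add: B_def)
  show thesis
  proof (rule that[of "4 * B"])
    show "4 * B > 0" using B by simp
    fix \<Omega> z \<xi> and b c :: complex
    assume A: "open \<Omega>" "z \<in> \<Omega>" "b \<notin> \<Omega>" "c \<notin> \<Omega>" "b \<noteq> c" "norm (z - b) \<le> 4 * norm (c - b)"
    define d where "d = norm (c - b)"
    have d: "d > 0" using A by (simp add: d_def)
    have "norm \<xi> / (4 * B * d) \<le> kobayashi_metric \<Omega> z \<xi>"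
      unfolding kobayashi_metric_def
    proof (rule cInf_greatest[OF kobayashi_metric_nonempty[OF A(1,2)]])
      fix r assume "r \<in> {r. r > 0 \<and> (\<exists>g. g holomorphic_on ball 0 1 \<and> g ` ball 0 1 \<subseteq> \<Omega> \<and>
                          g 0 = z \<and> complex_of_real r * deriv g 0 = \<xi>)}"
      then obtain g where r: "r > 0" and g: "g holomorphic_on ball 0 1" "g ` ball 0 1 \<subseteq> \<Omega>" "g 0 = z"
        "complex_of_real r * deriv g 0 = \<xi>" by blast
      \<comment> \<open>Halving the argument gives a function holomorphic on the closed disc; its
        bound on radius 1/2 is one for g on radius 1/4.\<close>
      define G where "G = (\<lambda>s. (g (s / 2) - b) / (c - b))"
      have "g \<circ> (\<lambda>s. s / 2) holomorphic_on cball 0 1"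
        by (rule holomorphic_on_compose_gen[OF _ g(1)]) (auto intro!: holomorphic_intros)
      then have hG: "G holomorphic_on cball 0 1"
        unfolding G_def o_def using A by (intro holomorphic_intros) auto
      have bd: "norm (g s - b) \<le> B * d" if "norm s \<le> 1/4" for s
      proof -
        have "norm (G (2 * s)) \<le> exp (pi * exp (pi * (2 + 2 * 4 + 12 * (1/2) / (1 - 1/2))))"
        proof (rule Schottky[OF hG])
          show "norm (G 0) \<le> 4" using A g by (simp add: G_def norm_divide field_simps)
          show "\<not> (G s = 0 \<or> G s = 1)" if "s \<in> cball 0 1" for s
          proof -
            have "g (s / 2) \<in> \<Omega>" using g(2) that by (auto simp: image_subset_iff)
            then show ?thesis using A by (auto simp: G_def)
          qed
        qed (use that in \<open>auto simp: norm_mult\<close>)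
        then have "norm (G (2 * s)) \<le> B" by (simp add: B_def)
        then show ?thesis using d by (simp add: G_def norm_divide d_def field_simps)
      qed
      have sub: "cball 0 (1/4) \<subseteq> ball (0::complex) 1" by auto
      have hg: "(\<lambda>s. g s - b) holomorphic_on cball 0 (1/4)"
        using holomorphic_on_subset[OF g(1) sub] by (intro holomorphic_intros)
      have "norm ((deriv ^^ 1) (\<lambda>s. g s - b) 0) \<le> fact 1 * (B * d) / (1/4) ^ 1"
        using hg holomorphic_on_subset[OF hg ball_subset_cball] bd
        by (intro Cauchy_inequality) (auto intro: holomorphic_on_imp_continuous_on)
      moreover have "((\<lambda>s. g s - b) has_field_derivative deriv g 0) (at 0)"
        using g holomorphic_derivI[OF g(1), of 0] by (auto intro!: derivative_eq_intros)
      then have "deriv (\<lambda>s. g s - b) 0 = deriv g 0" by (rule DERIV_imp_deriv)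
      ultimately have "norm (deriv g 0) \<le> 4 * B * d" by simp
      then have "r * norm (deriv g 0) \<le> r * (4 * B * d)" using r by (intro mult_left_mono) auto
      moreover have "norm \<xi> = r * norm (deriv g 0)" using g(4) r by (auto simp: norm_mult)
      ultimately show "norm \<xi> / (4 * B * d) \<le> r" using B d by (simp add: field_simps)
    qed
    then show "norm \<xi> \<le> 4 * B * norm (c - b) * kobayashi_metric \<Omega> z \<xi>"
      using B d by (simp add: d_def[symmetric] field_simps)
  qed
qed

text \<open>A function whose rate of change is dominated by the metric along the path varies by at
  most the length. The time s permits stopping where the domination ceases to be known.\<close>

lemma kobayashi_length_lower_bound:
  fixes g g' :: "real \<Rightarrow> real"
  assumes s: "0 \<le> s" "s \<le> 1" and S: "finite S"
    and cont: "continuous_on {0..s} g"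
    and der: "\<And>t. t \<in> {0<..<s} - S \<Longrightarrow> (g has_real_derivative g' t) (at t)"
    and cont': "continuous_on ({0<..<s} - S) g'"
    and le: "\<And>t. t \<in> {0<..<s} - S \<Longrightarrow>
      \<bar>g' t\<bar> \<le> kobayashi_metric \<Omega> (\<gamma> t) (vector_derivative \<gamma> (at t))"
  shows "ennreal \<bar>g s - g 0\<bar> \<le> kobayashi_length \<Omega> \<gamma>"
proof -
  define I where "I = {0<..<s} - S"
  define G where "G = (\<lambda>t. indicator I t *\<^sub>R g' t)"
  have "open I" unfolding I_def using S by (intro open_Diff finite_imp_closed) auto
  then have "I \<in> sets borel" by (rule borel_open)
  then have "G \<in> borel_measurable borel"
    unfolding G_def using cont'
    by (intro borel_measurable_continuous_on_indicator) (auto simp: I_def)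
  then have mG: "G \<in> borel_measurable lborel" by simp
  have J: "(\<integral>\<^sup>+ t. ennreal \<bar>G t\<bar> \<partial>lborel)
      \<le> kobayashi_length \<Omega> \<gamma>"
    unfolding kobayashi_length_def
  proof (rule nn_integral_mono)
    fix t :: real
    show "ennreal \<bar>G t\<bar> \<le> ennreal (kobayashi_metric \<Omega> (\<gamma> t) (vector_derivative \<gamma> (at t))) * indicator {0..1} t"
    proof (cases "t \<in> I")
      case True
      then have "t \<in> {0..1}" using s by (auto simp: I_def)
      then show ?thesis using le True by (simp add: G_def I_def ennreal_leI)
    qed (simp add: G_def)
  qed
  show ?thesis
  \<comment> \<open>\<open>g'\<close> may be unbounded near the exceptional points. If the integral
    of |G| diverges, so does the length; otherwise the Lebesgue integral of G exists and agrees with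
    the increment of g.\<close>
  proof (cases "(\<integral>\<^sup>+ t. ennreal \<bar>G t\<bar> \<partial>lborel) = \<infinity>")
    case True then show ?thesis using J by (simp add: top_unique)
  next
    case False
    then have int: "integrable lborel G"
      using mG by (intro integrableI_bounded) (auto simp: top.not_eq_extremum less_top)
    have "(g' has_integral (g s - g 0)) {0..s}"
      by (rule fundamental_theorem_of_calculus_interior_strong[OF S s(1) _ cont])
        (use der in \<open>auto simp: has_real_derivative_iff_has_vector_derivative\<close>)
    then have "(G has_integral (g s - g 0)) {0..s}"
      by (rule has_integral_spike_finite[rotated 2, of _ _ _ "insert 0 (insert s S)"])
        (use S in \<open>auto simp: G_def I_def indicator_def\<close>)
    then have "(G has_integral (g s - g 0)) UNIV"
      by (rule has_integral_on_superset) (auto simp: G_def I_def)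
    then have "g s - g 0 = integral\<^sup>L lborel G"
      using has_integral_integral_lborel[OF int] has_integral_unique by blast
    then have "\<bar>g s - g 0\<bar> \<le> (\<integral>t. \<bar>G t\<bar> \<partial>lborel)"
      using integral_norm_bound[of lborel G] by simp
    then have "ennreal \<bar>g s - g 0\<bar> \<le> ennreal (\<integral>t. \<bar>G t\<bar> \<partial>lborel)" by (rule ennreal_leI)
    also have "\<dots> = (\<integral>\<^sup>+ t. ennreal \<bar>G t\<bar> \<partial>lborel)"
      using int by (intro nn_integral_eq_integral[symmetric]) auto
    finally show ?thesis using J by simp
  qed
qed

section \<open>Points outside the basin and outside the grand orbit\<close>

context parabolic_polynomial
begin

lemma iterate_DERIV_zero: "((f ^^ n) has_field_derivative 1) (at 0)"
proof (induction n)
  case 0 show ?case by (simp add: id_def)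
next
  case (Suc n)
  have "(f has_field_derivative 1) (at 0)"
    using step_limits(1) by (simp add: has_field_derivative_iff)
  then have "(f has_field_derivative 1) (at ((f ^^ n) 0))" by simp
  from DERIV_chain[OF this Suc] show ?case by (simp add: o_def)
qed

text \<open>The iterate fixes 0 with derivative 1, so by Cauchy's inequality its maximum on the
  circle is at least r. Hence iterates cannot tend to 0 uniformly on a circle around 0.\<close>

lemma not_small_on_circle:
  assumes "r > 0" shows "\<exists>z. norm z = r \<and> norm ((f ^^ n) z) \<ge> r"
proof (rule ccontr)
  assume "\<not> ?thesis"
  then have lt: "norm ((f ^^ n) z) < r" if "norm z = r" for z using that by force
  have "compact (sphere (0::complex) r)" "sphere (0::complex) r \<noteq> {}" using assms by auto
  moreover have "continuous_on (sphere 0 r) (\<lambda>z. norm ((f ^^ n) z))"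
    by (intro continuous_on_norm iterate_continuous)
  ultimately obtain z0 where z0: "z0 \<in> sphere 0 r"
    "\<And>z. z \<in> sphere 0 r \<Longrightarrow> norm ((f ^^ n) z) \<le> norm ((f ^^ n) z0)"
    using continuous_attains_sup by metis
  have "norm ((deriv ^^ 1) (f ^^ n) 0) \<le> fact 1 * norm ((f ^^ n) z0) / r ^ 1"
    using assms z0(2)
    by (intro Cauchy_inequality iterate_holomorphic iterate_continuous) auto
  moreover have "deriv (f ^^ n) 0 = 1" using iterate_DERIV_zero by (rule DERIV_imp_deriv)
  moreover have "norm ((f ^^ n) z0) < r" using lt z0(1) by simp
  ultimately show False using assms by (simp add: field_simps)
qed

lemma basin_converges:
  assumes "z \<in> basin"
  shows "(\<lambda>n. (f ^^ n) z) \<longlonglongrightarrow> 0" "(f ^^ n) z \<noteq> 0"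
    "(\<lambda>k. complex_of_real (root m (real k)) * (f ^^ k) z) \<longlonglongrightarrow> v"
  using assms unfolding parabolic_basin_def converges_from_direction_def by simp_all

text \<open>For \<open>m = 1\<close> an arc inside the basin would close up to a circle around \<open>0\<close> on which the iterates
  tend to \<open>0\<close> uniformly; for \<open>m \<ge> 2\<close> the endpoint of the arc belongs to the neighbouring basin.\<close>

lemma omitted_near_repelling_direction:
  assumes b: "0 < b" "b \<le> pi / 2"
  obtains X where "\<And>x. x \<ge> X \<Longrightarrow>
    \<exists>t. \<bar>t - pi\<bar> \<le> b \<and> v * exp (- Complex x t / of_nat m) \<notin> basin"
proof (cases "m = 1")
  case True
  obtain X where X: "\<And>z. \<lbrakk>z \<noteq> 0; \<bar>Im (lc z)\<bar> \<le> pi - b; Re (lc z) \<ge> X\<rbrakk>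
      \<Longrightarrow> z \<in> basin \<and> (\<forall>n. norm ((f ^^ n) z) < 1)"
    using sector_basin[OF zero_less_one b] by blast
  show thesis
  proof (rule that[of X], rule ccontr)
    fix x assume x: "x \<ge> X" and "\<not> (\<exists>t. \<bar>t - pi\<bar> \<le> b \<and> v * exp (- Complex x t / of_nat m) \<notin> basin)"
    then have all: "v * exp (- Complex x t / of_nat m) \<in> basin" if "\<bar>t - pi\<bar> \<le> b" for t using that by blast
    define r where "r = norm v * exp (- x)"
    have r: "r > 0" using v_nonzero by (simp add: r_def)
    have "z \<in> basin" if z: "norm z = r" for z
    proof -
      have z0: "z \<noteq> 0" using z r by auto
      have re: "Re (lc z) = x"
      proof -
        have "norm z = norm v * exp (- Re (lc z))"
          using norm_of[of "lc z"] of_lc[OF z0] True by simp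
        then show ?thesis using z v_nonzero by (simp add: r_def)
      qed
      have im: "\<bar>Im (lc z)\<bar> \<le> pi"
        using mpi_less_Im_Ln[of "z / v"] Im_Ln_le_pi[of "z / v"] z0 v_nonzero True
        by (simp add: log_coord_def abs_le_iff)
      have *: "v * exp (- lc z / of_nat m) = z" using of_lc[OF z0] .
      \<comment> \<open>For m = 1 the arc around argument pi closes up the sector: arguments close
        to -pi reach that arc after adding 2 pi.\<close>
      consider "\<bar>Im (lc z)\<bar> \<le> pi - b" | "Im (lc z) > pi - b" | "Im (lc z) < - (pi - b)" by linarith
      then show ?thesis
      proof cases
        case 1
        then show ?thesis using X[OF z0] re x by simp
      next
        case 2
        have "lc z = Complex x (Im (lc z))" using re by (simp add: complex_eq_iff)
        then show ?thesis using all[of "Im (lc z)"] * im 2 by auto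
      next
        case 3
        have "Complex x (Im (lc z) + 2 * pi) = lc z + 2 * of_real pi * \<i>"
          using re by (simp add: complex_eq_iff)
        then have "exp (- Complex x (Im (lc z) + 2 * pi) / of_nat m) = exp (- lc z / of_nat m)"
          using True by (simp add: exp_diff exp_minus exp_add)
        then show ?thesis using all[of "Im (lc z) + 2 * pi"] * im 3 by auto
      qed
    qed
    then have "sphere 0 r \<subseteq> basin" by auto
    then obtain N where N: "\<And>n z. \<lbrakk>n \<ge> N; z \<in> sphere 0 r\<rbrakk> \<Longrightarrow> norm ((f ^^ n) z) < r"
      using basin_uniform[OF compact_sphere _ r] by metis
    show False using not_small_on_circle[OF r, of N] N[OF order.refl] by force
  qed
next
  case False
  \<comment> \<open>u is a primitive m-th root of unity, so v * u is the next attraction vector,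
    beyond the repelling direction at argument pi.\<close>
  define u where "u = exp (- of_real (2 * pi / real m) * \<i>)"
  have um: "u ^ m = 1"
  proof -
    have "u ^ m = exp (of_nat m * (- of_real (2 * pi / real m) * \<i>))" unfolding u_def by (rule exp_of_nat_mult[symmetric])
    also have "of_nat m * (- of_real (2 * pi / real m) * \<i>) = - (2 * of_real pi * \<i>)" using m by (simp add: field_simps)
    finally show ?thesis by (simp add: exp_minus)
  qed
  have u1: "u \<noteq> 1"
  proof
    assume "u = 1"
    then obtain n :: int where n: "- (2 * pi / real m) = of_int (2 * n) * pi"
      by (auto simp: u_def exp_eq_1)
    then have "pi * (- 1) = pi * (of_int n * real m)" using m by (simp add: field_simps)
    then have "- 1 = of_int n * real m" using mult_left_cancel[OF pi_neq_zero] by blast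
    then have "of_int (n * int m) = (of_int (- 1) :: real)" by simp
    then have "n * int m = - 1" by (simp only: of_int_eq_iff)
    then have "int m dvd 1" by (metis dvd_minus_iff dvd_triv_right)
    then show False using False m by simp
  qed
  interpret nb: parabolic_polynomial m a "v * u" p h f
  proof
    show "attraction_vector m a (v * u)"
      using v_power um by (simp add: attraction_vector_def power_mult_distrib)
  qed (fact m a p f)+
  obtain X where X: "\<And>z. \<lbrakk>z \<noteq> 0; \<bar>Im (nb.lc z)\<bar> \<le> pi - b; Re (nb.lc z) \<ge> X\<rbrakk>
      \<Longrightarrow> z \<in> nb.basin \<and> (\<forall>n. norm ((f ^^ n) z) < 1)"
    using nb.sector_basin[OF zero_less_one b] by blast
  show thesis
  proof (rule that[of X])
    fix x assume x: "x \<ge> X"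
    \<comment> \<open>Argument pi + b relative to v is argument b - pi relative to v * u, which is
      on the edge of a sector inside the neighbouring basin.\<close>
    define l where "l = Complex x (b - pi)"
    define z where "z = v * exp (- Complex x (pi + b) / of_nat m)"
    have "Complex x (pi + b) = l + 2 * of_real pi * \<i>" by (simp add: l_def complex_eq_iff)
    then have "- Complex x (pi + b) / of_nat m = - of_real (2 * pi / real m) * \<i> + - l / of_nat m"
      using m by (simp add: field_simps)
    then have zu: "z = v * u * exp (- l / of_nat m)"
      unfolding z_def u_def by (simp only: exp_add mult.assoc)
    have "\<bar>Im l\<bar> < pi" using b by (simp add: l_def abs_if)
    then have "nb.lc z = l" unfolding zu by (rule nb.lc_of)
    moreover have "z \<noteq> 0" using v_nonzero by (simp add: z_def)
    moreover have "\<bar>Im l\<bar> \<le> pi - b" "Re l \<ge> X" using b x by (auto simp: l_def abs_if)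
    ultimately have "z \<in> nb.basin" using X[of z] by simp
    then have "z \<notin> basin"
      using LIMSEQ_unique[OF nb.basin_converges(3) basin_converges(3), of z] u1 v_nonzero by auto
    then show "\<exists>t. \<bar>t - pi\<bar> \<le> b \<and> v * exp (- Complex x t / of_nat m) \<notin> basin"
      unfolding z_def using b by (intro exI[of _ "pi + b"]) auto
  qed
qed

text \<open>Injectivity near 0 allows pulling back an equation between iterates of z and q. This
  ends either with an iterate of z equal to \<open>(f ^^ n0) q\<close>, although the orbit of z
  stays closer to 0 than that, or with z on the tail of the orbit of q, where the argument is below
  pi/2.\<close>

lemma grand_orbit_avoids_sector:
  assumes q: "q \<in> basin" and b: "0 < b" "b \<le> pi / 2"
    and N: "open N" "0 \<in> N" "inj_on f N"
  obtains X where "\<And>z l k. \<lbrakk>z \<noteq> 0; pi / 2 \<le> Im (lc z); Im (lc z) \<le> pi - b; Re (lc z) \<ge> X\<rbrakk>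
    \<Longrightarrow> (f ^^ l) z \<noteq> (f ^^ k) q"
proof -
  obtain r0 where r0: "r0 > 0" "ball 0 r0 \<subseteq> N" using N openE by blast
  have "eventually (\<lambda>n. norm ((f ^^ n) q) < r0) sequentially"
    using tendstoD[OF basin_converges(1)[OF q] r0(1)] by simp
  with basin_orbit_tangential[OF q, of 0]
  have "eventually (\<lambda>n. norm ((f ^^ n) q) < r0 \<and> \<bar>Im (lc ((f ^^ n) q))\<bar> < pi / 2) sequentially"
    by eventually_elim auto
  then obtain n0 where n0: "\<And>n. n \<ge> n0 \<Longrightarrow> norm ((f ^^ n) q) < r0 \<and> \<bar>Im (lc ((f ^^ n) q))\<bar> < pi / 2"
    unfolding eventually_sequentially by blast
  define c where "c = norm ((f ^^ n0) q)"
  have c: "c > 0" using basin_converges(2)[OF q] by (simp add: c_def)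
  obtain X where X: "\<And>z. \<lbrakk>z \<noteq> 0; \<bar>Im (lc z)\<bar> \<le> pi - b; Re (lc z) \<ge> X\<rbrakk>
      \<Longrightarrow> z \<in> basin \<and> (\<forall>n. norm ((f ^^ n) z) < min r0 c)"
    using sector_basin[of "min r0 c", OF _ b] r0 c by (metis min_less_iff_conj)
  show thesis
  proof (rule that[of X])
    fix z l k
    assume z: "z \<noteq> 0" "pi / 2 \<le> Im (lc z)" "Im (lc z) \<le> pi - b" "Re (lc z) \<ge> X"
    have orb: "norm ((f ^^ n) z) < r0" "norm ((f ^^ n) z) < c" for n
      using X[of z] z b by auto
    show "(f ^^ l) z \<noteq> (f ^^ k) q"
    proof
      assume eq: "(f ^^ l) z = (f ^^ k) q"
      \<comment> \<open>After n0 further iterates, every point of the orbit of q met in the pullback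
        has index at least n0.\<close>
      have eq': "(f ^^ (n0 + l)) z = (f ^^ (n0 + k)) q" using eq by (simp add: funpow_add)
      have pullback: "j \<le> n0 + l \<Longrightarrow> j \<le> k \<Longrightarrow> (f ^^ (n0 + l - j)) z = (f ^^ (n0 + k - j)) q" for j
      proof (induction j)
        case 0 then show ?case using eq' by simp
      next
        case (Suc j)
        define i where "i = n0 + l - Suc j"
        define i' where "i' = n0 + k - Suc j"
        have i: "n0 + l - j = Suc i" "n0 + k - j = Suc i'" "i' \<ge> n0" using Suc by (auto simp: i_def i'_def)
        have "f ((f ^^ i) z) = f ((f ^^ i') q)" using Suc i by simp
        moreover have "(f ^^ i) z \<in> N" "(f ^^ i') q \<in> N" using orb n0[OF i(3)] r0 by (auto simp: subset_iff)
        ultimately show ?case using N(3) by (auto simp: inj_on_def i_def i'_def)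
      qed
      show False
      proof (cases "k \<le> n0 + l")
        case True
        then show False using pullback[of k] orb(2)[of "n0 + l - k"] by (simp add: c_def)
      next
        case False
        then have "z = (f ^^ (n0 + k - (n0 + l))) q" using pullback[of "n0 + l"] by simp
        moreover have "n0 + k - (n0 + l) \<ge> n0" using False by simp
        ultimately have "\<bar>Im (lc z)\<bar> < pi / 2" using n0 by metis
        then show False using z by linarith
      qed
    qed
  qed
qed

end

section \<open>Points far from the grand orbit\<close>

context parabolic_polynomial
begin

text \<open>Two points outside the basin are found whose distances to z are at most, and whose
  mutual distance is exactly of, the order y |z| / m, so the estimate for two omitted values
  applies. K is independent of b, which only influences X.\<close>

lemma kobayashi_metric_near_repelling_direction:
  obtains K where "K > 0"
    "\<And>b. \<lbrakk>0 < b; b \<le> 1/8\<rbrakk> \<Longrightarrow> \<exists>X. \<forall>\<Omega> x y \<xi>. open \<Omega> \<longrightarrow> \<Omega> \<subseteq> basin \<longrightarrow> x \<ge> X \<longrightarrow> b \<le> y \<longrightarrow> y \<le> 1/8 \<longrightarrow>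
      v * exp (- Complex x (pi - y) / of_nat m) \<in> \<Omega> \<longrightarrow>
      real m * norm \<xi> \<le> K * norm (v * exp (- Complex x (pi - y) / of_nat m)) * y *
        kobayashi_metric \<Omega> (v * exp (- Complex x (pi - y) / of_nat m)) \<xi>"
proof -
  obtain M where M: "M > 0"
    "\<And>\<Omega> z \<xi> b c. \<lbrakk>open \<Omega>; z \<in> \<Omega>; b \<notin> \<Omega>; c \<notin> \<Omega>; b \<noteq> c; norm (z - b) \<le> 4 * norm (c - b)\<rbrakk>
      \<Longrightarrow> norm \<xi> \<le> M * norm (c - b) * kobayashi_metric \<Omega> z \<xi>"
    using kobayashi_metric_two_omitted by blast
  show thesis
  proof (rule that[of "8 * M"])
    show "8 * M > 0" using M by simp
    fix b :: real assume b: "0 < b" "b \<le> 1/8"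
    have "b \<le> pi / 2" using b pi_ge_two by linarith
    then obtain X where X: "\<And>x. x \<ge> X \<Longrightarrow>
        \<exists>t. \<bar>t - pi\<bar> \<le> b \<and> v * exp (- Complex x t / of_nat m) \<notin> basin"
      using omitted_near_repelling_direction[OF b(1)] by blast
    show "\<exists>X. \<forall>\<Omega> x y \<xi>. open \<Omega> \<longrightarrow> \<Omega> \<subseteq> basin \<longrightarrow> x \<ge> X \<longrightarrow> b \<le> y \<longrightarrow> y \<le> 1/8 \<longrightarrow>
      v * exp (- Complex x (pi - y) / of_nat m) \<in> \<Omega> \<longrightarrow>
      real m * norm \<xi> \<le> 8 * M * norm (v * exp (- Complex x (pi - y) / of_nat m)) * y *
        kobayashi_metric \<Omega> (v * exp (- Complex x (pi - y) / of_nat m)) \<xi>"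
    proof (intro exI[of _ "X + 1"] allI impI)
      fix \<Omega> x y \<xi>
      assume \<Omega>: "open \<Omega>" "\<Omega> \<subseteq> basin" and x: "x \<ge> X + 1" and y: "b \<le> y" "y \<le> 1/8"
        and z\<Omega>: "v * exp (- Complex x (pi - y) / of_nat m) \<in> \<Omega>"
      define z where "z = v * exp (- Complex x (pi - y) / of_nat m)"
      have nz: "norm z > 0" using v_nonzero by (simp add: z_def)
      have y0: "y > 0" using y b by simp
      have m1: "real m \<ge> 1" using m by simp
      have "x \<ge> X" "x - y \<ge> X" using x y by auto
      then obtain t1 t2 where t: "\<bar>t1 - pi\<bar> \<le> b" "v * exp (- Complex x t1 / of_nat m) \<notin> basin"
          "\<bar>t2 - pi\<bar> \<le> b" "v * exp (- Complex (x - y) t2 / of_nat m) \<notin> basin"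
        using X by metis
      \<comment> \<open>The second point is taken at real part x - y: its modulus is |z| exp (y /
        m), whereas |c1| = |z|, so the two are at least |z| y / m apart. As y <= 1/8, the exponents
        are small and |exp w - 1| is comparable to |w|.\<close>
      define w1 where "w1 = Complex 0 (pi - y - t1) / of_nat m"
      define w2 where "w2 = Complex y (pi - y - t2) / of_nat m"
      define c1 where "c1 = z * exp w1"
      define c2 where "c2 = z * exp w2"
      have "Complex x t1 = Complex x (pi - y) - Complex 0 (pi - y - t1)" by (simp add: complex_eq_iff)
      then have "- Complex x t1 / of_nat m = - Complex x (pi - y) / of_nat m + w1"
        by (simp add: w1_def diff_divide_distrib)
      then have c1: "c1 = v * exp (- Complex x t1 / of_nat m)"
        unfolding c1_def z_def by (simp only: exp_add mult.assoc)
      have "Complex (x - y) t2 = Complex x (pi - y) - Complex y (pi - y - t2)" by (simp add: complex_eq_iff)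
      then have "- Complex (x - y) t2 / of_nat m = - Complex x (pi - y) / of_nat m + w2"
        by (simp add: w2_def diff_divide_distrib)
      then have c2: "c2 = v * exp (- Complex (x - y) t2 / of_nat m)"
        unfolding c2_def z_def by (simp only: exp_add mult.assoc)
      define d where "d = y / real m"
      have d: "d > 0" "d \<le> 1/8" using y0 y m1
        by (auto simp: d_def divide_le_eq intro: order_trans)
      have "norm (Complex 0 (pi - y - t1)) \<le> 2 * y"
        using t(1) y b cmod_le[of "Complex 0 (pi - y - t1)"] by simp
      then have w1: "norm w1 \<le> 2 * d"
        using m1 by (simp add: w1_def d_def norm_divide divide_right_mono)
      have "norm (Complex y (pi - y - t2)) \<le> 3 * y"
        using t(3) y b cmod_le[of "Complex y (pi - y - t2)"] by simp
      then have w2: "norm w2 \<le> 3 * d"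
        using m1 by (simp add: w2_def d_def norm_divide divide_right_mono)
      have e1: "norm (exp w1 - 1) \<le> 3 * d"
        using norm_exp_bounds(2)[of w1] w1 d by linarith
      have e2: "norm (exp w2 - 1) \<le> 9/2 * d"
        using norm_exp_bounds(2)[of w2] w2 d by linarith
      have "norm (exp w2) = exp d" "norm (exp w1) = 1"
        by (simp_all add: w2_def w1_def d_def)
      moreover have "exp d \<ge> 1 + d" by (rule exp_ge_add_one_self)
      ultimately have e3: "norm (exp w2 - exp w1) \<ge> d"
        using norm_triangle_ineq2[of "exp w2" "exp w1"] by linarith
      have "norm (exp w2 - exp w1) \<le> norm (exp w2 - 1) + norm (exp w1 - 1)"
        using norm_triangle_ineq4[of "exp w2 - 1" "exp w1 - 1"] by simp
      then have e4: "norm (exp w2 - exp w1) \<le> 8 * d" using e1 e2 d by linarith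
      have c21: "c2 - c1 = z * (exp w2 - exp w1)" by (simp add: c1_def c2_def algebra_simps)
      have "norm (z - c1) = norm z * norm (exp w1 - 1)"
      proof -
        have "z - c1 = - (z * (exp w1 - 1))" by (simp add: c1_def algebra_simps)
        then show ?thesis by (simp only: norm_minus_cancel norm_mult)
      qed
      also have "\<dots> \<le> norm z * (4 * norm (exp w2 - exp w1))"
        using e1 e3 d nz by (intro mult_left_mono) auto
      also have "\<dots> = 4 * norm (c2 - c1)" by (simp add: c21 norm_mult)
      finally have "norm (z - c1) \<le> 4 * norm (c2 - c1)" .
      moreover have "c1 \<noteq> c2" using c21 e3 d nz by auto
      moreover have "c1 \<notin> \<Omega>" "c2 \<notin> \<Omega>" using t \<Omega> c1 c2 by auto
      ultimately have *: "norm \<xi> \<le> M * norm (c2 - c1) * kobayashi_metric \<Omega> z \<xi>"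
        using \<Omega> z\<Omega> by (intro M(2)) (auto simp: z_def)
      have "norm (c2 - c1) > 0" using \<open>c1 \<noteq> c2\<close> by simp
      then have "M * norm (c2 - c1) > 0" using M by simp
      then have F0: "kobayashi_metric \<Omega> z \<xi> \<ge> 0" using *
        by (meson norm_ge_zero order_trans zero_le_mult_iff not_less)
      have "norm (c2 - c1) \<le> norm z * (8 * d)"
        using e4 nz by (simp add: c21 norm_mult mult_left_mono)
      then have "M * norm (c2 - c1) * kobayashi_metric \<Omega> z \<xi>
          \<le> M * (norm z * (8 * d)) * kobayashi_metric \<Omega> z \<xi>"
        using M F0 by (intro mult_right_mono mult_left_mono) auto
      then have "norm \<xi> \<le> M * (norm z * (8 * d)) * kobayashi_metric \<Omega> z \<xi>" using * by linarith
      then have "real m * norm \<xi> \<le> real m * (M * (norm z * (8 * d)) * kobayashi_metric \<Omega> z \<xi>)"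
        by (intro mult_left_mono) auto
      also have "\<dots> = 8 * M * norm z * y * kobayashi_metric \<Omega> z \<xi>"
        using m1 by (simp add: d_def)
      finally show "real m * norm \<xi> \<le> 8 * M * norm (v * exp (- Complex x (pi - y) / of_nat m)) * y *
        kobayashi_metric \<Omega> (v * exp (- Complex x (pi - y) / of_nat m)) \<xi>" by (simp add: z_def)
    qed
  qed
qed

end

context parabolic_polynomial
begin

text \<open>The estimate covers all open subsets of the basin, hence whichever component contains
  z0. A path from z0 to the grand orbit must leave the box \<open>E\<close>, and each of the three
  faces of \<open>E\<close> costs at least C.\<close>

lemma exists_far_point:
  assumes q: "q \<in> basin" and N: "open N" "0 \<in> N" "inj_on f N" and C: "C > 0"
  obtains z0 where "z0 \<in> basin"
    "\<And>\<Omega> \<gamma> l k. \<lbrakk>open \<Omega>; \<Omega> \<subseteq> basin; valid_path \<gamma>; path_image \<gamma> \<subseteq> \<Omega>; pathstart \<gamma> = z0;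
      (f ^^ l) (pathfinish \<gamma>) = (f ^^ k) q\<rbrakk> \<Longrightarrow> ennreal C \<le> kobayashi_length \<Omega> \<gamma>"
proof -
  obtain K where K: "K > 0"
    "\<And>b. \<lbrakk>0 < b; b \<le> 1/8\<rbrakk> \<Longrightarrow> \<exists>X. \<forall>\<Omega> x y \<xi>. open \<Omega> \<longrightarrow> \<Omega> \<subseteq> basin \<longrightarrow> x \<ge> X \<longrightarrow> b \<le> y \<longrightarrow> y \<le> 1/8 \<longrightarrow>
      v * exp (- Complex x (pi - y) / of_nat m) \<in> \<Omega> \<longrightarrow>
      real m * norm \<xi> \<le> K * norm (v * exp (- Complex x (pi - y) / of_nat m)) * y *
        kobayashi_metric \<Omega> (v * exp (- Complex x (pi - y) / of_nat m)) \<xi>"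
    using kobayashi_metric_near_repelling_direction by blast
  define D where "D = K * C"
  have D: "D > 0" using K C by (simp add: D_def)
  \<comment> \<open>On the scale ln y the heights b, \<eta>, 1/8 are equally spaced with step D = K
    * C, and the metric dominates |d ln y| / K.\<close>
  define \<eta> where "\<eta> = exp (- D) / 8"
  define b where "b = exp (- 2 * D) / 8"
  have b: "0 < b" "b < \<eta>" "\<eta> < 1/8" using D by (auto simp: b_def \<eta>_def)
  then have b8: "b \<le> 1/8" by simp
  have bpi: "b \<le> pi / 2" using b8 pi_ge_two by linarith
  obtain X1 where X1: "\<And>\<Omega> x y \<xi>. \<lbrakk>open \<Omega>; \<Omega> \<subseteq> basin; x \<ge> X1; b \<le> y; y \<le> 1/8;
      v * exp (- Complex x (pi - y) / of_nat m) \<in> \<Omega>\<rbrakk> \<Longrightarrow>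
      real m * norm \<xi> \<le> K * norm (v * exp (- Complex x (pi - y) / of_nat m)) * y *
        kobayashi_metric \<Omega> (v * exp (- Complex x (pi - y) / of_nat m)) \<xi>"
    using K(2)[OF b(1) b8] by metis
  obtain X2 where X2: "\<And>z l k. \<lbrakk>z \<noteq> 0; pi / 2 \<le> Im (lc z); Im (lc z) \<le> pi - b; Re (lc z) \<ge> X2\<rbrakk>
    \<Longrightarrow> (f ^^ l) z \<noteq> (f ^^ k) q"
    using grand_orbit_avoids_sector[OF q b(1) bpi N] by blast
  obtain X3 where X3: "\<And>z. \<lbrakk>z \<noteq> 0; \<bar>Im (lc z)\<bar> \<le> pi - b; Re (lc z) \<ge> X3\<rbrakk>
      \<Longrightarrow> z \<in> basin \<and> (\<forall>n. norm ((f ^^ n) z) < 1)"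
    using sector_basin[OF zero_less_one b(1) bpi] by blast
  define x1 where "x1 = max X1 (max X2 X3)"
  \<comment> \<open>Radially the metric is at least 8 |dx| / K because y <= 1/8, so a distance of D
    + 1 costs more than C.\<close>
  define x0 where "x0 = x1 + D + 1"
  \<comment> \<open>e points in the repelling direction at argument pi. Measured from e, the height
    y is \<open>- Im (H z)\<close>, and the cut stays away from the box even for m = 1, where that
    direction is the cut of \<open>lc\<close>.\<close>
  define e where "e = v * exp (- (of_real pi * \<i>) / of_nat m)"
  have e: "e \<noteq> 0" using v_nonzero by (simp add: e_def)
  define H where "H = log_coord m e"
  have vz: "e * exp (- Complex x (- y) / of_nat m) = v * exp (- Complex x (pi - y) / of_nat m)" for x y
  proof -
    have "Complex x (pi - y) = of_real pi * \<i> + Complex x (- y)" by (simp add: complex_eq_iff)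
    then have "- Complex x (pi - y) / of_nat m = - (of_real pi * \<i>) / of_nat m + - Complex x (- y) / of_nat m"
      by (simp add: diff_divide_distrib)
    then show ?thesis unfolding e_def by (simp only: exp_add mult.assoc)
  qed
  have zH: "z = v * exp (- Complex (Re (H z)) (pi - (- Im (H z))) / of_nat m)" if "z \<noteq> 0" for z
    using of_log_coord[OF e m that] vz[of "Re (H z)" "- Im (H z)"] by (simp add: H_def)
  define T where "T = {z. Re (z / e) > 0}"
  have oT: "open T" unfolding T_def using e
    by (intro open_Collect_less continuous_intros) auto
  have HT: "(H has_field_derivative - of_nat m / z) (at z)" if "z \<in> T" for z
  proof -
    have "z \<noteq> 0" using that by (auto simp: T_def)
    have "z / e \<notin> \<real>\<^sub>\<le>\<^sub>0" using that by (auto simp: T_def complex_nonpos_Reals_iff)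
    then show ?thesis unfolding H_def log_coord_def using e \<open>z \<noteq> 0\<close>
      by (auto intro!: derivative_eq_intros)
  qed
  have cT: "continuous_on T H"
    using HT DERIV_isCont continuous_at_imp_continuous_on by blast
  define E where "E = {z \<in> T. Re (H z) > x1 \<and> Im (H z) > - (1/8) \<and> Im (H z) < - b}"
  have oE: "open E"
  proof -
    have "E = T \<inter> H -` {l. Re l > x1 \<and> Im l > - (1/8) \<and> Im l < - b}" by (auto simp: E_def)
    moreover have "open {l. Re l > x1 \<and> Im l > - (1/8) \<and> Im l < - b}"
      by (intro open_Collect_conj open_Collect_less continuous_intros)
    ultimately show ?thesis using continuous_open_preimage[OF cT oT] by (simp only:)
  qed
  \<comment> \<open>This closed condition passes to the closure of the box, so the exit point of a
    path also lies in \<open>T\<close>, where \<open>H\<close> is holomorphic.\<close>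
  have half: "Re (z / e) \<ge> norm (z / e) / 2" if "z \<noteq> 0" "\<bar>Im (H z)\<bar> \<le> 1" for z
  proof -
    have "z / e = exp (- H z / of_nat m)"
      using of_log_coord[OF e m \<open>z \<noteq> 0\<close>] e by (simp add: H_def field_simps)
    moreover have "cos (Im (H z) / real m) \<ge> 1 / 2"
    proof -
      have "\<bar>Im (H z)\<bar> / real m \<le> 1 / 1" using that m by (intro frac_le) auto
      then have "\<bar>Im (H z) / real m\<bar> \<le> 1" by simp
      then have "\<bar>Im (H z) / real m\<bar> \<le> pi / 3" using pi_gt3 by linarith
      then have "cos \<bar>Im (H z) / real m\<bar> \<ge> cos (pi / 3)" by (intro cos_monotone_0_pi_le) auto
      then show ?thesis by (simp only: cos_60 cos_abs_real)
    qed
    then have "exp (Re (- H z / of_nat m)) * (1 / 2) \<le> exp (Re (- H z / of_nat m)) * cos (Im (H z) / real m)"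
      by (intro mult_left_mono) auto
    ultimately show ?thesis by (simp add: Re_exp)
  qed
  have Eco: "z \<noteq> 0" "lc z = Complex (Re (H z)) (pi + Im (H z))" if "z \<in> E" for z
  proof -
    show "z \<noteq> 0" using that by (auto simp: E_def T_def)
    then have "lc z = lc (v * exp (- Complex (Re (H z)) (pi - (- Im (H z))) / of_nat m))"
      using zH by metis
    also have "\<dots> = Complex (Re (H z)) (pi - (- Im (H z)))"
      using that b pi_gt3 by (intro lc_of) (auto simp: E_def)
    finally show "lc z = Complex (Re (H z)) (pi + Im (H z))" by simp
  qed
  have avoid: "(f ^^ l) z \<noteq> (f ^^ k) q" if "z \<in> E" for z l k
    using that X2[OF Eco(1)[OF that]] b pi_gt3 by (auto simp: Eco(2)[OF that] E_def x1_def)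
  define z0 where "z0 = e * exp (- Complex x0 (- \<eta>) / of_nat m)"
  have Hz0: "H z0 = Complex x0 (- \<eta>)"
    unfolding H_def z0_def using b pi_gt3 by (intro log_coord_of e m) auto
  have z00: "z0 \<noteq> 0" using e by (simp add: z0_def)
  have z0E: "z0 \<in> E"
  proof -
    have "Re (z0 / e) \<ge> norm (z0 / e) / 2" using z00 b by (intro half) (auto simp: Hz0)
    moreover have "norm (z0 / e) > 0" using z00 e by simp
    ultimately have "Re (z0 / e) > 0" by linarith
    then have "z0 \<in> T" unfolding T_def by simp
    then show ?thesis using b D by (simp add: E_def Hz0 x0_def)
  qed
  have z0A: "z0 \<in> basin"
    using X3[of z0] z00 z0E b pi_gt3 Eco(2)[OF z0E] by (auto simp: E_def x1_def)
  show thesis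
  proof (rule that[OF z0A])
    fix \<Omega> \<gamma> l k
    assume \<Omega>: "open \<Omega>" "\<Omega> \<subseteq> basin" and \<gamma>: "valid_path \<gamma>" "path_image \<gamma> \<subseteq> \<Omega>" "pathstart \<gamma> = z0"
      and fin: "(f ^^ l) (pathfinish \<gamma>) = (f ^^ k) q"
    have "pathfinish \<gamma> \<notin> E" using avoid fin by blast
    \<comment> \<open>\<open>u\<close> is the first exit time from the open box.\<close>
    then obtain u where u: "0 \<le> u" "u \<le> 1" "\<And>t. 0 \<le> t \<and> t < u \<Longrightarrow> \<gamma> t \<in> interior E"
        "\<gamma> u \<notin> interior E" "u = 0 \<or> \<gamma> u \<in> closure E"
      using subpath_to_frontier_explicit[OF valid_path_imp_path[OF \<gamma>(1)]] by blast
    have u0: "u > 0" using u(1,4) z0E oE \<gamma>(3) by (cases "u = 0") (auto simp: pathstart_def interior_open)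
    have \<gamma>E: "\<gamma> t \<in> E" if "0 \<le> t" "t < u" for t using u(3) that oE by (simp add: interior_open)
    have \<gamma>\<Omega>: "\<gamma> t \<in> \<Omega>" if "0 \<le> t" "t \<le> 1" for t using \<gamma>(2) that by (auto simp: path_image_def)
    have uT: "\<gamma> u \<in> T"
    proof -
      have "E \<subseteq> {z. Re (z / e) \<ge> norm (z / e) / 2}" using half Eco(1) b by (auto simp: E_def)
      moreover have "closed {z. Re (z / e) \<ge> norm (z / e) / 2}"
        using e by (intro closed_Collect_le continuous_intros) auto
      ultimately have "closure E \<subseteq> {z. Re (z / e) \<ge> norm (z / e) / 2}" by (rule closure_minimal)
      then have "Re (\<gamma> u / e) \<ge> norm (\<gamma> u / e) / 2" using u(5) u0 by auto
      moreover have "\<gamma> u \<noteq> 0" using \<gamma>\<Omega>[of u] u \<Omega> basin_converges(2)[of 0 0] by auto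
      then have "norm (\<gamma> u / e) > 0" using e by simp
      ultimately have "Re (\<gamma> u / e) > 0" by linarith
      then show ?thesis by (simp add: T_def)
    qed
    have \<gamma>T: "\<gamma> ` {0..u} \<subseteq> T" using uT \<gamma>E by (fastforce simp: E_def le_less)
    define h where "h = H \<circ> \<gamma>"
    have c\<gamma>: "continuous_on {0..u} \<gamma>"
      using valid_path_imp_path[OF \<gamma>(1)] u by (auto simp: path_def intro: continuous_on_subset)
    have ch: "continuous_on {0..u} h"
      unfolding h_def using c\<gamma> cT \<gamma>T by (intro continuous_on_compose) (auto intro: continuous_on_subset)
    obtain S where S: "finite S" "\<And>t. t \<in> {0..1} - S \<Longrightarrow> \<gamma> differentiable at t"
      "continuous_on ({0..1} - S) (\<lambda>t. vector_derivative \<gamma> (at t))"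
      using valid_path_regular[OF \<gamma>(1)] by metis
    define h' where "h' = (\<lambda>t. vector_derivative \<gamma> (at t) * (- of_nat m / \<gamma> t))"
    have sub: "t \<in> {0..1} - S" "\<gamma> t \<in> E" "\<gamma> t \<in> T" "\<gamma> t \<noteq> 0" if "t \<in> {0<..<u} - S" for t
      using that u \<gamma>E[of t] Eco(1) by (auto simp: E_def)
    have dh: "(h has_vector_derivative h' t) (at t)" if "t \<in> {0<..<u} - S" for t
      unfolding h_def h'_def
      using S(2)[OF sub(1)[OF that]] HT[OF sub(3)[OF that]]
      by (intro field_vector_diff_chain_at) (auto simp: vector_derivative_works)
    have ch': "continuous_on ({0<..<u} - S) h'"
      unfolding h'_def using sub u
      by (intro continuous_intros continuous_on_subset[OF S(3)] continuous_on_subset[OF c\<gamma>]) auto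
    have chs: "continuous_on ({0<..<u} - S) h" using ch by (rule continuous_on_subset) auto
    have bound: "norm (h' t) \<le> K * - Im (h t) * kobayashi_metric \<Omega> (\<gamma> t) (vector_derivative \<gamma> (at t))"
      "0 \<le> kobayashi_metric \<Omega> (\<gamma> t) (vector_derivative \<gamma> (at t))"
      "- Im (h t) > b" "- Im (h t) < 1/8" if "t \<in> {0<..<u} - S" for t
    proof -
      note s = sub[OF that]
      define x where "x = Re (H (\<gamma> t))"
      define y where "y = - Im (H (\<gamma> t))"
      define F where "F = kobayashi_metric \<Omega> (\<gamma> t) (vector_derivative \<gamma> (at t))"
      have xy: "x \<ge> X1" "b < y" "y < 1/8" using s(2) by (auto simp: E_def x_def y_def x1_def)
      have eq: "v * exp (- Complex x (pi - y) / of_nat m) = \<gamma> t"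
        using zH[OF s(4)] by (simp add: x_def y_def)
      have "\<gamma> t \<in> \<Omega>" using \<gamma>\<Omega> s(1) by auto
      then have *: "real m * norm (vector_derivative \<gamma> (at t)) \<le> K * norm (\<gamma> t) * y * F"
        using X1[OF \<Omega>, of x y "vector_derivative \<gamma> (at t)"] xy unfolding eq F_def by simp
      show "- Im (h t) > b" "- Im (h t) < 1/8" using xy by (auto simp: h_def y_def)
      have ng: "norm (\<gamma> t) > 0" using s by simp
      have "norm (h' t) = real m * norm (vector_derivative \<gamma> (at t)) / norm (\<gamma> t)"
        by (simp add: h'_def norm_mult norm_divide)
      also have "\<dots> \<le> K * y * F" using * ng by (simp add: field_simps)
      finally have **: "norm (h' t) \<le> K * y * F" .
      then show "norm (h' t) \<le> K * - Im (h t) * kobayashi_metric \<Omega> (\<gamma> t) (vector_derivative \<gamma> (at t))"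
        by (simp add: h_def y_def F_def)
      have "0 \<le> K * y * F" using ** norm_ge_zero order_trans by blast
      moreover have "K * y > 0" using K xy b by simp
      ultimately show "0 \<le> kobayashi_metric \<Omega> (\<gamma> t) (vector_derivative \<gamma> (at t))"
        by (simp add: F_def zero_le_mult_iff)
    qed
    \<comment> \<open>The exit time is included by continuity, which keeps
      \<open>ln (- Im (h t))\<close> continuous on the closed interval.\<close>
    have Imb: "Im (h t) \<le> - b" if "t \<in> {0..u}" for t
    proof -
      have cl: "closure {0..<u} = {0..u}" using u0 by simp
      show ?thesis
      proof (rule continuous_le_on_closure[of "{0..<u}" "\<lambda>t. Im (h t)"])
        show "continuous_on (closure {0..<u}) (\<lambda>t. Im (h t))" unfolding cl using ch by (intro continuous_intros)
        show "t \<in> closure {0..<u}" using that cl by simp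
        show "Im (h s) \<le> - b" if "s \<in> {0..<u}" for s using \<gamma>E[of s] that by (auto simp: h_def E_def)
      qed
    qed
    have h0: "h 0 = Complex x0 (- \<eta>)" using \<gamma>(3) Hz0 by (simp add: h_def pathstart_def)
    have radial: "ennreal \<bar>Re (h u) * 8 / K - Re (h 0) * 8 / K\<bar> \<le> kobayashi_length \<Omega> \<gamma>"
    proof (rule kobayashi_length_lower_bound[OF u(1,2) S(1)])
      show "continuous_on {0..u} (\<lambda>t. Re (h t) * 8 / K)" using ch K by (intro continuous_intros) auto
      show "((\<lambda>t. Re (h t) * 8 / K) has_real_derivative Re (h' t) * 8 / K) (at t)" if "t \<in> {0<..<u} - S" for t
        using dh[OF that] K by (auto intro!: derivative_eq_intros)
      show "continuous_on ({0<..<u} - S) (\<lambda>t. Re (h' t) * 8 / K)" using ch' K by (intro continuous_intros) auto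
      show "\<bar>Re (h' t) * 8 / K\<bar> \<le> kobayashi_metric \<Omega> (\<gamma> t) (vector_derivative \<gamma> (at t))"
        if "t \<in> {0<..<u} - S" for t
      proof -
        note bb = bound[OF that]
        have "K * - Im (h t) * kobayashi_metric \<Omega> (\<gamma> t) (vector_derivative \<gamma> (at t))
            \<le> K * (1/8) * kobayashi_metric \<Omega> (\<gamma> t) (vector_derivative \<gamma> (at t))"
          using bb K by (intro mult_right_mono mult_left_mono) auto
        then have "\<bar>Re (h' t)\<bar> \<le> K * (1/8) * kobayashi_metric \<Omega> (\<gamma> t) (vector_derivative \<gamma> (at t))"
          using bb(1) abs_Re_le_cmod[of "h' t"] by linarith
        then show ?thesis using K by (simp add: abs_mult field_simps)
      qed
    qed
    have angular: "ennreal \<bar>ln (- Im (h u)) / K - ln (- Im (h 0)) / K\<bar> \<le> kobayashi_length \<Omega> \<gamma>"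
    proof (rule kobayashi_length_lower_bound[OF u(1,2) S(1)])
      show "continuous_on {0..u} (\<lambda>t. ln (- Im (h t)) / K)"
        using ch K Imb b by (intro continuous_intros) force+
      show "((\<lambda>t. ln (- Im (h t)) / K) has_real_derivative Im (h' t) / Im (h t) / K) (at t)"
        if "t \<in> {0<..<u} - S" for t
      proof -
        have "((\<lambda>t. - Im (h t)) has_real_derivative - Im (h' t)) (at t)"
          using dh[OF that] by (auto intro!: derivative_eq_intros)
        then have "((\<lambda>t. ln (- Im (h t))) has_real_derivative (1 / (- Im (h t))) * (- Im (h' t))) (at t)"
          using bound(3)[OF that] b by (intro DERIV_chain2[OF DERIV_ln_divide]) auto
        from DERIV_cdivide[OF this, of K] show ?thesis by simp
      qed
      show "continuous_on ({0<..<u} - S) (\<lambda>t. Im (h' t) / Im (h t) / K)"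
        using ch' chs K bound(3) b by (intro continuous_intros) force+
      show "\<bar>Im (h' t) / Im (h t) / K\<bar> \<le> kobayashi_metric \<Omega> (\<gamma> t) (vector_derivative \<gamma> (at t))"
        if "t \<in> {0<..<u} - S" for t
      proof -
        note bb = bound[OF that]
        have "\<bar>Im (h' t)\<bar> \<le> K * - Im (h t) * kobayashi_metric \<Omega> (\<gamma> t) (vector_derivative \<gamma> (at t))"
          using bb(1) abs_Im_le_cmod[of "h' t"] by linarith
        then have *: "\<bar>Im (h' t)\<bar> \<le> kobayashi_metric \<Omega> (\<gamma> t) (vector_derivative \<gamma> (at t)) * (- Im (h t) * K)"
          by (simp only: mult_ac)
        have pos: "- Im (h t) * K > 0" using bb(3) b K(1) by (intro mult_pos_pos) auto
        have "\<bar>Im (h t)\<bar> = - Im (h t)" "\<bar>K\<bar> = K" using bb(3) b K(1) by auto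
        then have "\<bar>Im (h' t) / Im (h t) / K\<bar> = \<bar>Im (h' t)\<bar> / (- Im (h t) * K)"
          by (simp only: abs_divide abs_mult divide_divide_eq_left)
        also have "\<dots> \<le> kobayashi_metric \<Omega> (\<gamma> t) (vector_derivative \<gamma> (at t))"
          using * pos by (subst pos_divide_le_eq)
        finally show ?thesis .
      qed
    qed
    have "\<gamma> u \<notin> E" using u(4) oE by (simp add: interior_open)
    then consider "Re (h u) \<le> x1" | "Im (h u) \<le> - (1/8)" | "Im (h u) \<ge> - b"
      using uT by (fastforce simp: E_def h_def)
    then show "ennreal C \<le> kobayashi_length \<Omega> \<gamma>"
    proof cases
      case 1
      have "C \<le> 8 * (D + 1) / K" using K D C by (simp add: D_def field_simps)
      also have "\<dots> \<le> (Re (h 0) * 8 - Re (h u) * 8) / K"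
        using 1 K by (intro divide_right_mono) (auto simp: h0 x0_def)
      also have "\<dots> \<le> \<bar>Re (h u) * 8 / K - Re (h 0) * 8 / K\<bar>" unfolding diff_divide_distrib by (subst abs_minus_commute) (rule abs_ge_self)
      finally show ?thesis using radial ennreal_leI order_trans by blast
    next
      case 2
      have "ln (1 / 8) \<le> ln (- Im (h u))" using 2 by (subst ln_le_cancel_iff) auto
      moreover have "ln (- Im (h 0)) = ln (1 / 8) - D" by (simp add: h0 \<eta>_def ln_div)
      ultimately have "D / K \<le> (ln (- Im (h u)) - ln (- Im (h 0))) / K"
        using K by (intro divide_right_mono) auto
      also have "\<dots> \<le> \<bar>ln (- Im (h u)) / K - ln (- Im (h 0)) / K\<bar>" unfolding diff_divide_distrib by (rule abs_ge_self)
      finally have "C \<le> \<bar>ln (- Im (h u)) / K - ln (- Im (h 0)) / K\<bar>" using K by (simp add: D_def)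
      then show ?thesis using angular ennreal_leI order_trans by blast
    next
      case 3
      have "ln (- Im (h u)) \<le> ln b" using 3 Imb[of u] b u by (subst ln_le_cancel_iff) auto
      moreover have "ln (- Im (h 0)) = ln b + D" by (simp add: h0 \<eta>_def b_def ln_div)
      ultimately have "D / K \<le> (ln (- Im (h 0)) - ln (- Im (h u))) / K"
        using K by (intro divide_right_mono) auto
      also have "\<dots> \<le> \<bar>ln (- Im (h u)) / K - ln (- Im (h 0)) / K\<bar>" unfolding diff_divide_distrib by (subst abs_minus_commute) (rule abs_ge_self)
      finally have "C \<le> \<bar>ln (- Im (h u)) / K - ln (- Im (h 0)) / K\<bar>" using K by (simp add: D_def)
      then show ?thesis using angular ennreal_leI order_trans by blast
    qed
  qed
qed

end

section \<open>Density in the frontier\<close>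

text \<open>A Vitali argument: by Montel's theorem a sequence violating uniform smallness has a
  locally uniformly convergent subsequence, whose limit vanishes on U and hence on D by the identity
  theorem.\<close>

lemma converges_uniformly_of_locally_zero:
  fixes F :: "nat \<Rightarrow> complex \<Rightarrow> complex"
  assumes D: "open D" "connected D" and hol: "\<And>n. F n holomorphic_on D"
    and bd: "\<And>n z. z \<in> D \<Longrightarrow> norm (F n z) \<le> B"
    and U: "open U" "U \<noteq> {}" "U \<subseteq> D" "\<And>z. z \<in> U \<Longrightarrow> (\<lambda>n. F n z) \<longlonglongrightarrow> 0"
    and K: "compact K" "K \<subseteq> D" and e: "e > 0"
  obtains N where "\<And>n z. \<lbrakk>n \<ge> N; z \<in> K\<rbrakk> \<Longrightarrow> norm (F n z) < e"
proof (rule ccontr)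
  assume "\<not> thesis"
  then have "\<forall>N. \<exists>n z. n \<ge> N \<and> z \<in> K \<and> norm (F n z) \<ge> e" using that by (meson not_le)
  then obtain n z where nz: "\<And>N. n N \<ge> N" "\<And>N. z N \<in> K" "\<And>N. norm (F (n N) (z N)) \<ge> e" by metis
  obtain g r where g: "g holomorphic_on D" "strict_mono (r :: nat \<Rightarrow> nat)"
    "\<And>x. x \<in> D \<Longrightarrow> (\<lambda>k. F (n (r k)) x) \<longlonglongrightarrow> g x"
    "\<And>K. \<lbrakk>compact K; K \<subseteq> D\<rbrakk> \<Longrightarrow> uniform_limit K ((\<lambda>k. F (n k)) \<circ> r) g sequentially"
  proof (rule Montel[OF D(1), of "range F" "\<lambda>k. F (n k)"])
    show "\<exists>B. \<forall>h\<in>range F. \<forall>z\<in>K. norm (h z) \<le> B" if "K \<subseteq> D" for K using bd that by blast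
  qed (use hol in auto)
  \<comment> \<open>The indices \<open>n N\<close> need not increase with N, but
    \<open>n N \<ge> N\<close> makes \<open>n (r k)\<close> tend to infinity.\<close>
  have "filterlim (\<lambda>k. n (r k)) at_top sequentially"
  proof (rule filterlim_at_top_mono[OF filterlim_subseq[OF g(2)]])
    show "\<forall>\<^sub>F k in sequentially. r k \<le> n (r k)" using nz(1) by simp
  qed
  then have "g x = 0" if "x \<in> U" for x
    using g(3)[of x] filterlim_compose[OF U(4)[OF that]] U(3) that LIMSEQ_unique by blast
  then have g0: "g x = 0" if "x \<in> D" for x
    using analytic_continuation_open[OF U(1) D(1) U(2) D(2) U(3) g(1) holomorphic_on_const[of 0]] that by blast
  have "eventually (\<lambda>k. \<forall>x\<in>K. dist (((\<lambda>k. F (n k)) \<circ> r) k x) (g x) < e) sequentially"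
    using g(4)[OF K] e unfolding uniform_limit_iff by blast
  then obtain k where "\<And>x. x \<in> K \<Longrightarrow> dist (F (n (r k)) x) (g x) < e"
    unfolding eventually_sequentially by auto
  then have "norm (F (n (r k)) (z (r k))) < e" using nz(2)[of "r k"] g0 K(2) by fastforce
  then show False using nz(3)[of "r k"] by linarith
qed

context parabolic_polynomial
begin

text \<open>Subtracting a constant leaves the coefficient a of degree m + 1 untouched, so the
  difference is a nonconstant polynomial and has a root.\<close>

lemma f_surj: "\<exists>w. f w = z"
proof -
  have "coeff (p - [:z:]) (m + 1) = a" using m
    by (simp add: p coeff_monom_mult coeff_pCons split: nat.splits)
  moreover from this have "m + 1 \<le> degree (p - [:z:])" using a by (intro le_degree) simp
  ultimately obtain w where "(\<Sum>i\<le>degree (p - [:z:]). coeff (p - [:z:]) i * w ^ i) = 0"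
    using fundamental_theorem_of_algebra[of "coeff (p - [:z:])" "degree (p - [:z:])"] a
    by (metis One_nat_def Suc_le_mono add.commute atLeastAtMost_iff le0 plus_1_eq_Suc)
  then have "poly (p - [:z:]) w = 0" by (simp only: poly_altdef)
  then show ?thesis by (auto simp: f)
qed

text \<open>By backward invariance all iterates on a disc missing X omit every point of X, and two
  omitted values give local bounds. Convergence to 0 then spreads from the basin to the frontier
  point; the remaining work is to identify its direction as v.\<close>

lemma frontier_basin_subset_closure:
  assumes op: "open basin" and pre: "\<And>z. f z \<in> basin \<Longrightarrow> z \<in> basin"
    and X: "X \<subseteq> basin" "X \<noteq> {}" "\<And>w. f w \<in> X \<Longrightarrow> w \<in> X"
  shows "frontier basin \<subseteq> closure X"
proof (rule subsetI, rule ccontr)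
  fix \<zeta> assume \<zeta>: "\<zeta> \<in> frontier basin" "\<zeta> \<notin> closure X"
  have \<zeta>A: "\<zeta> \<notin> basin" using \<zeta>(1) op by (simp add: frontier_def interior_open)
  have backn: "(f ^^ n) z \<in> basin \<Longrightarrow> z \<in> basin" for n z
    by (induction n arbitrary: z) (auto simp: funpow_swap1 intro: pre)
  have Xn: "(f ^^ n) z \<in> X \<Longrightarrow> z \<in> X" for n z
    by (induction n arbitrary: z) (auto simp: funpow_swap1 intro: X(3))
  obtain r where r: "r > 0" "ball \<zeta> r \<subseteq> - closure X"
    using openE[of "- closure X" \<zeta>] \<zeta>(2) by auto
  obtain x where x: "x \<in> X" using X(2) by blast
  \<comment> \<open>The two omitted values are a point of X and a preimage of it. They differ, since
    a fixed point attracted to 0 is 0 itself, which the basin excludes.\<close>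
  obtain y where y: "f y = x" using f_surj by blast
  have yX: "y \<in> X" using X(3) x y by simp
  have yx: "y \<noteq> x"
  proof
    assume "y = x"
    then have fx: "(f ^^ n) x = x" for n using y by (induction n) auto
    have xA: "x \<in> basin" using x X(1) by blast
    have "x = 0" using basin_converges(1)[OF xA] by (simp add: fx LIMSEQ_const_iff)
    then show False using basin_converges(2)[OF xA, of 0] by simp
  qed
  have omit: "(f ^^ n) z \<noteq> x" "(f ^^ n) z \<noteq> y" if "z \<in> ball \<zeta> r" for n z
  proof -
    have "z \<notin> X" using that r(2) closure_subset[of X] by blast
    then show "(f ^^ n) z \<noteq> x" "(f ^^ n) z \<noteq> y" using Xn[of n z] x yX by metis+
  qed
  have near: "\<exists>z\<in>basin. dist \<zeta> z < e" if "e > 0" for e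
    using \<zeta>(1) that unfolding frontier_def by (metis DiffD1 closure_approachable dist_commute)
  \<comment> \<open>Schottky's theorem is applied around a basin point, whose orbit is bounded, and
    not around \<zeta>. The radii fit because r/8 + r/2 < r and r/8 + r/16 < r/4.\<close>
  obtain z1 where z1: "z1 \<in> basin" "dist \<zeta> z1 < r / 8"
    using near[of "r / 8"] r(1) by auto
  obtain R where R: "\<And>n. norm ((f ^^ n) z1) \<le> R"
    using convergent_imp_Bseq[OF convergentI[OF basin_converges(1)[OF z1(1)]]] by (meson BseqE)
  define R0 where "R0 = (R + norm x) / norm (y - x)"
  define B where "B = exp (pi * exp (pi * (2 + 2 * R0 + 12 * (1/2) / (1 - 1/2)))) * norm (y - x) + norm x"
  define D where "D = ball z1 (r / 4)"
  have bd: "norm ((f ^^ n) z) \<le> B" if "z \<in> D" for n z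
  proof -
    define G where "G = (\<lambda>s. ((f ^^ n) (z1 + of_real (r / 2) * s) - x) / (y - x))"
    have "(f ^^ n) \<circ> (\<lambda>s. z1 + of_real (r / 2) * s) holomorphic_on cball 0 1"
      by (intro holomorphic_on_compose iterate_holomorphic holomorphic_intros)
    then have hG: "G holomorphic_on cball 0 1" unfolding G_def o_def
      using yx by (intro holomorphic_intros) auto
    define s where "s = (z - z1) / of_real (r / 2)"
    have zs: "z = z1 + of_real (r / 2) * s" using r by (simp add: s_def field_simps)
    have "norm (G s) \<le> exp (pi * exp (pi * (2 + 2 * R0 + 12 * (1/2) / (1 - 1/2))))"
    proof (rule Schottky[OF hG])
      show "norm (G 0) \<le> R0"
        using R[of n] norm_triangle_ineq4[of "(f ^^ n) z1" x]
        by (simp add: G_def R0_def norm_divide divide_right_mono)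
      show "\<not> (G t = 0 \<or> G t = 1)" if "t \<in> cball 0 1" for t
      proof -
        have "norm (of_real (r / 2) * t) \<le> r / 2 * 1"
          unfolding norm_mult using that r by (intro mult_mono) auto
        then have "dist z1 (z1 + of_real (r / 2) * t) \<le> r / 2" by (simp add: dist_norm)
        then have "z1 + of_real (r / 2) * t \<in> ball \<zeta> r"
          using z1(2) dist_triangle[of \<zeta> "z1 + of_real (r / 2) * t" z1] r by simp
        then show ?thesis using omit[of "z1 + of_real (r / 2) * t" n] yx by (auto simp: G_def)
      qed
      show "norm s \<le> 1/2"
      proof -
        have "norm s = norm (z - z1) / (r / 2)"
          unfolding s_def norm_divide norm_of_real using r by simp
        moreover have "norm (z - z1) < r / 4"
          using that by (simp add: D_def dist_norm norm_minus_commute)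
        then have "norm (z - z1) / (r / 2) \<le> (r / 4) / (r / 2)"
          using r by (intro divide_right_mono) auto
        ultimately show ?thesis using r by simp
      qed
    qed simp_all
    moreover have "norm (G s) = norm ((f ^^ n) z - x) / norm (y - x)"
      unfolding G_def zs[symmetric] norm_divide ..
    ultimately have "norm ((f ^^ n) z - x)
        \<le> exp (pi * exp (pi * (2 + 2 * R0 + 12 * (1/2) / (1 - 1/2)))) * norm (y - x)"
      using yx by (simp only: pos_divide_le_eq zero_less_norm_iff right_minus_eq not_False_eq_True)
    then show ?thesis unfolding B_def using norm_triangle_ineq2[of "(f ^^ n) z" x] by linarith
  qed
  define K where "K = cball \<zeta> (r / 16)"
  have KD: "K \<subseteq> D"
  proof
    fix z assume "z \<in> K"
    then show "z \<in> D" using z1(2) r dist_triangle[of z1 z \<zeta>]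
      by (simp add: K_def D_def dist_commute)
  qed
  have unif: "\<exists>N. \<forall>n\<ge>N. \<forall>z\<in>K. norm ((f ^^ n) z) < e" if "e > 0" for e
  proof -
    have z1D: "z1 \<in> basin \<inter> D" using z1 r by (simp add: D_def)
    obtain N where "\<And>n z. \<lbrakk>n \<ge> N; z \<in> K\<rbrakk> \<Longrightarrow> norm ((f ^^ n) z) < e"
    proof (rule converges_uniformly_of_locally_zero[of D "\<lambda>n. f ^^ n" B "basin \<inter> D" K e])
      show "open D" "connected D" by (simp_all add: D_def)
      show "f ^^ n holomorphic_on D" for n by (rule iterate_holomorphic)
      show "norm ((f ^^ n) z) \<le> B" if "z \<in> D" for n z using bd that .
      show "open (basin \<inter> D)" using op by (simp add: D_def open_Int)
      show "basin \<inter> D \<noteq> {}" using z1D by blast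
      show "(\<lambda>n. (f ^^ n) z) \<longlonglongrightarrow> 0" if "z \<in> basin \<inter> D" for z
        using basin_converges(1) that by blast
      show "compact K" by (simp add: K_def)
    qed (use KD \<open>e > 0\<close> in auto)
    then show ?thesis by blast
  qed
  obtain z2 where z2: "z2 \<in> basin" "dist \<zeta> z2 < r / 32"
    using near[of "r / 32"] r(1) by auto
  \<comment> \<open>An iterate reaching 0 would be open there and cover a disc around 0, on which
    later iterates would be uniformly small, contrary to \<open>not_small_on_circle\<close>.\<close>
  have nz: "(f ^^ n) z \<noteq> 0" if "z \<in> ball \<zeta> (r / 16)" for n z
  proof
    assume 0: "(f ^^ n) z = 0"
    have "z2 \<in> ball \<zeta> (r / 16)" using z2 r by simp
    moreover have "(f ^^ n) z2 \<noteq> 0" using basin_converges(2) z2 by blast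
    ultimately have "\<not> (f ^^ n) constant_on ball \<zeta> (r / 16)"
      using 0 that unfolding constant_on_def by metis
    then have "open ((f ^^ n) ` ball \<zeta> (r / 16))"
      by (intro open_mapping_thm[OF iterate_holomorphic]) auto
    moreover have "0 \<in> (f ^^ n) ` ball \<zeta> (r / 16)" using 0 that by (metis image_eqI)
    ultimately obtain s where s: "s > 0" "cball 0 s \<subseteq> (f ^^ n) ` ball \<zeta> (r / 16)"
      by (metis open_contains_cball)
    obtain N where N: "\<And>k z. \<lbrakk>k \<ge> N; z \<in> K\<rbrakk> \<Longrightarrow> norm ((f ^^ k) z) < s" using unif[OF s(1)] by blast
    obtain w where w: "norm w = s" "norm ((f ^^ N) w) \<ge> s" using not_small_on_circle[OF s(1)] by blast
    then obtain z' where z': "z' \<in> ball \<zeta> (r / 16)" "w = (f ^^ n) z'" using s(2) by (force simp: subset_iff)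
    then have "(f ^^ N) w = (f ^^ (N + n)) z'" by (simp add: funpow_add)
    moreover have "z' \<in> K" using z' by (simp add: K_def)
    ultimately show False using N[of "N + n" z'] w by simp
  qed
  define K2 where "K2 = cball \<zeta> (r / 32)"
  have K2: "K2 \<subseteq> ball \<zeta> (r / 16)" "K2 \<subseteq> K" "\<zeta> \<in> K2" "z2 \<in> K2"
    using r z2 by (auto simp: K2_def K_def)
  \<comment> \<open>The coordinate w along the orbits. From N on its real part grows by at least 1/2
    per step on all of \<open>K2\<close>, so it ends up in the right half-plane, where
    \<open>Ln\<close> is continuous.\<close>
  define W where "W = (\<lambda>n z. (v / (f ^^ n) z) ^ m)"
  have cW: "continuous_on K2 (W n)" for n
    unfolding W_def using nz K2(1) by (intro continuous_intros iterate_continuous) auto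
  obtain r0 where r0: "r0 > 0" "\<And>z. \<lbrakk>z \<noteq> 0; norm z < r0\<rbrakk> \<Longrightarrow>
    f z \<noteq> 0 \<and> norm (f z / z - 1) < 1/2 \<and> norm ((v / f z) ^ m - (v / z) ^ m - 1) < 1/2"
    using step_close[of "1/2"] by auto
  obtain N where N: "\<And>n z. \<lbrakk>n \<ge> N; z \<in> K\<rbrakk> \<Longrightarrow> norm ((f ^^ n) z) < r0" using unif[OF r0(1)] by blast
  have step: "Re (W (Suc n) z) \<ge> Re (W n z) + 1/2" if "n \<ge> N" "z \<in> K2" for n z
  proof -
    have "norm (W (Suc n) z - W n z - 1) < 1/2"
      using r0(2)[of "(f ^^ n) z"] nz[OF subsetD[OF K2(1) that(2)]]
        N[OF that(1) subsetD[OF K2(2) that(2)]] by (simp add: W_def)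
    then have "\<bar>Re (W (Suc n) z - W n z - 1)\<bar> < 1/2" using abs_Re_le_cmod le_less_trans by blast
    then show ?thesis unfolding abs_less_iff minus_complex.sel one_complex.sel by linarith
  qed
  have "compact ((\<lambda>z. Re (W N z)) ` K2)"
    using cW by (intro compact_continuous_image continuous_intros) (auto simp: K2_def)
  then have "bounded ((\<lambda>z. Re (W N z)) ` K2)" by (rule compact_imp_bounded)
  then obtain b0 where b0: "\<And>z. z \<in> K2 \<Longrightarrow> \<bar>Re (W N z)\<bar> \<le> b0"
    unfolding bounded_real by blast
  have grow: "Re (W (N + k) z) \<ge> real k / 2 - b0" if "z \<in> K2" for k z
  proof (induction k)
    case 0 show ?case using b0[OF that] by auto
  next
    case (Suc k)
    then show ?case using step[OF _ that, of "N + k"] by (simp add: field_simps)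
  qed
  obtain X' where X': "\<And>z. \<lbrakk>z \<noteq> 0; \<bar>Im (lc z)\<bar> \<le> pi - pi / 2; Re (lc z) \<ge> X'\<rbrakk>
      \<Longrightarrow> z \<in> basin \<and> (\<forall>n. norm ((f ^^ n) z) < 1)"
    using sector_basin[OF zero_less_one, of "pi / 2"] by auto
  obtain k0 :: nat where k0: "real k0 > 2 * (exp X' + b0)" using reals_Archimedean2 by blast
  obtain M where M: "\<And>n. n \<ge> M \<Longrightarrow> \<bar>Im (lc ((f ^^ n) z2))\<bar> < pi / 2"
    using basin_orbit_tangential[OF z2(1), of 0] unfolding eventually_sequentially by blast
  define n where "n = max M (N + k0)"
  have n: "n \<ge> N + k0" "\<bar>Im (lc ((f ^^ n) z2))\<bar> < pi / 2" using M by (auto simp: n_def)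
  have ReW: "Re (W n z) > exp X'" if "z \<in> K2" for z
  proof -
    define k where "k = n - N"
    have k: "n = N + k" "k \<ge> k0" using n(1) by (auto simp: k_def)
    then have "real k > 2 * (exp X' + b0)" using k0 by linarith
    then show ?thesis using grow[OF that, of k] k by (simp add: field_simps)
  qed
  have ReW0: "Re (W n z) > 0" if "z \<in> K2" for z using ReW[OF that] exp_gt_zero[of X'] by linarith
  \<comment> \<open>\<open>s\<close> compares the iterate with v * (W n z)^(-1/m) for the principal
    root. It is continuous with values in the m-th roots of unity, hence constant on the connected
    \<open>K2\<close>, and it is 1 at the basin point \<open>z2\<close>. So the iterate of \<zeta>
    lies in the sector of v.\<close>
  define s where "s = (\<lambda>z. (f ^^ n) z / v * exp (Ln (W n z) / of_nat m))"
  have sm: "s z ^ m = 1" if "z \<in> K2" for z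
  proof -
    have "exp (Ln (W n z) / of_nat m) ^ m = exp (of_nat m * (Ln (W n z) / of_nat m))"
      by (rule exp_of_nat_mult[symmetric])
    also have "of_nat m * (Ln (W n z) / of_nat m) = Ln (W n z)" using m by simp
    also have "exp (Ln (W n z)) = W n z" using ReW0[OF that] by (intro exp_Ln) auto
    finally show ?thesis using nz K2(1) that v_nonzero
      by (auto simp: s_def power_mult_distrib W_def power_divide)
  qed
  have "continuous_on K2 s" unfolding s_def using ReW0 v_nonzero m
    by (intro continuous_intros iterate_continuous cW) (force simp: complex_nonpos_Reals_iff)+
  moreover have "finite (s ` K2)"
    using sm m by (intro finite_subset[OF _ finite_roots_unity[of m]]) auto
  moreover have "connected K2" by (simp add: K2_def convex_connected)
  ultimately have "s constant_on K2" by (intro continuous_finite_range_constant)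
  then have eq: "s \<zeta> = s z2" using K2 unfolding constant_on_def by metis
  have lnW: "lc ((f ^^ n) z2) = Ln (W n z2)"
  proof -
    have "W n z2 = exp (lc ((f ^^ n) z2))" using exp_lc basin_converges(2)[OF z2(1)] by (simp add: W_def)
    moreover have "Ln (exp (lc ((f ^^ n) z2))) = lc ((f ^^ n) z2)"
      using n(2) pi_gt_zero by (intro Ln_exp) linarith+
    ultimately show ?thesis by simp
  qed
  have "s z2 = 1"
  proof -
    have "(f ^^ n) z2 = v * exp (- Ln (W n z2) / of_nat m)"
      using of_lc[OF basin_converges(2)[OF z2(1), of n]] by (simp add: lnW)
    then show ?thesis using v_nonzero by (simp add: s_def exp_minus)
  qed
  then have "(f ^^ n) \<zeta> = v * exp (- Ln (W n \<zeta>) / of_nat m)"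
    using eq v_nonzero by (simp add: s_def exp_minus field_simps)
  moreover have im: "\<bar>Im (Ln (W n \<zeta>))\<bar> < pi / 2"
    using ReW0[OF K2(3)] Re_Ln_pos_lt_imp by blast
  ultimately have "lc ((f ^^ n) \<zeta>) = Ln (W n \<zeta>)" using lc_of pi_gt_zero by simp
  moreover have "Re (Ln (W n \<zeta>)) \<ge> X'"
  proof -
    have "W n \<zeta> \<noteq> 0" using ReW0[OF K2(3)] by auto
    moreover have "exp X' \<le> norm (W n \<zeta>)" using ReW[OF K2(3)] complex_Re_le_cmod[of "W n \<zeta>"] by linarith
    ultimately show ?thesis by (simp add: ln_ge_iff)
  qed
  moreover have "(f ^^ n) \<zeta> \<noteq> 0" using nz K2 by blast
  ultimately have "(f ^^ n) \<zeta> \<in> basin" using X'[of "(f ^^ n) \<zeta>"] im by simp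
  then show False using backn \<zeta>A by blast
qed

end

section \<open>The set \<open>X\<close> on the components of the basin\<close>

theorem corollaryD:
  fixes p h :: "complex poly" and f :: "complex \<Rightarrow> complex" and a v q :: complex
    and m :: nat and C :: real and A P Q X :: "complex set"
  assumes m: "m \<ge> 1" and a: "a \<noteq> 0"
    and p: "p = [:0, 1:] + monom a (m + 1) + monom 1 (m + 2) * h"
    and f: "f = poly p"
    and v: "attraction_vector m a v"
    and A: "A = parabolic_basin f m v"
    and P: "attracting_petal f m v P"
    and C: "C > 0"
    and q: "q \<in> P" "\<exists>t::real. t > 0 \<and> q = of_real t * v"
    and Q: "Q = (\<Union>l. \<Union>k. (f ^^ l) -` {(f ^^ k) q})"
    and X: "X = {z0 \<in> A. \<forall>\<Omega> \<in> components A. \<forall>q' \<in> Q.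
                   z0 \<in> \<Omega> \<and> q' \<in> \<Omega> \<longrightarrow> kobayashi_dist \<Omega> z0 q' \<ge> ennreal C}"
  shows "(\<forall>z \<in> X. \<forall>w \<in> f -` {z}. w \<in> X) \<and> frontier A \<subseteq> closure X"
proof -
  interpret parabolic_polynomial m a v p h f by (rule parabolic_polynomial.intro[OF m a p f v])
  obtain N where N: "open N" "0 \<in> N" "inj_on f N"
    using P by (auto simp: attracting_petal_def)
  have oP: "open P" and fP: "f ` P \<subseteq> P"
    and PA: "\<And>z. (\<forall>\<^sub>F k in sequentially. (f ^^ k) z \<in> P) \<longleftrightarrow> z \<in> A"
    using P by (auto simp: attracting_petal_def A parabolic_basin_def)
  have stay: "z \<in> P \<Longrightarrow> (f ^^ k) z \<in> P" for z k using fP by (induction k) auto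
  \<comment> \<open>The petal is forward invariant, so a single visit already means absorption. The
    basin is thus a union of open preimages.\<close>
  have A_eq: "A = (\<Union>n. (f ^^ n) -` P)"
  proof (intro equalityI subsetI)
    fix z assume "z \<in> A"
    then show "z \<in> (\<Union>n. (f ^^ n) -` P)" unfolding PA[symmetric] eventually_sequentially by auto
  next
    fix z assume "z \<in> (\<Union>n. (f ^^ n) -` P)"
    then obtain n where n: "(f ^^ n) z \<in> P" by auto
    have "(f ^^ k) z \<in> P" if "k \<ge> n" for k
      using stay[OF n, of "k - n"] that by (metis funpow_add comp_apply le_add_diff_inverse2)
    then show "z \<in> A" unfolding PA[symmetric] eventually_sequentially by blast
  qed
  have oA: "open A" unfolding A_eq by (intro open_UN ballI open_vimage oP iterate_continuous)
  have fA: "f z \<in> A \<longleftrightarrow> z \<in> A" for z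
    unfolding PA[symmetric] using eventually_sequentially_Suc[of "\<lambda>k. (f ^^ k) z \<in> P"]
    by (simp add: funpow_swap1)
  have qA: "q \<in> basin" unfolding A[symmetric] A_eq using q(1) by (auto intro!: exI[of _ 0])
  have pull: "w \<in> X" if "f w \<in> X" for w
  proof -
    have "ennreal C \<le> kobayashi_dist \<Omega> w q'"
      if \<Omega>: "\<Omega> \<in> components A" and q': "q' \<in> Q" and w: "w \<in> \<Omega>" and q'\<Omega>: "q' \<in> \<Omega>" for \<Omega> q'
    proof -
      have conn: "connected (f ` \<Omega>)"
        using in_components_connected[OF \<Omega>] iterate_continuous[of _ 1]
        by (intro connected_continuous_image) simp_all
      have subA: "f ` \<Omega> \<subseteq> A" using in_components_subset[OF \<Omega>] fA by blast
      \<comment> \<open>The connected image of a component lies in one component \<Omega>', so f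
        maps \<Omega> into \<Omega>' without increasing distances, and the grand orbit contains
        \<open>f q'\<close> with k raised by one.\<close>
      have "f w \<in> A" using \<open>f w \<in> X\<close> unfolding X by blast
      then have "f w \<in> \<Union>(components A)" by (simp only: Union_components)
      then obtain \<Omega>' where \<Omega>': "\<Omega>' \<in> components A" "f w \<in> \<Omega>'" by blast
      then have "\<Omega>' \<inter> f ` \<Omega> \<noteq> {}" using w by blast
      then have sub: "f ` \<Omega> \<subseteq> \<Omega>'" by (rule components_maximal[OF \<Omega>'(1) conn subA])
      obtain l k where "(f ^^ l) q' = (f ^^ k) q" using q' Q by auto
      then have "(f ^^ l) (f q') = (f ^^ Suc k) q" by (simp add: funpow_swap1[symmetric])
      then have "f q' \<in> Q" unfolding Q by blast
      then have "ennreal C \<le> kobayashi_dist \<Omega>' (f w) (f q')"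
        using \<open>f w \<in> X\<close> \<Omega>' sub q'\<Omega> unfolding X by blast
      also have "\<dots> \<le> kobayashi_dist \<Omega> w q'"
        using open_components[OF oA \<Omega>] f_holomorphic sub by (rule kobayashi_dist_image_le)
      finally show ?thesis .
    qed
    moreover have "w \<in> A" using that fA X by auto
    ultimately show ?thesis unfolding X by blast
  qed
  obtain z0 where z0: "z0 \<in> basin"
    "\<And>\<Omega> \<gamma> l k. \<lbrakk>open \<Omega>; \<Omega> \<subseteq> basin; valid_path \<gamma>; path_image \<gamma> \<subseteq> \<Omega>; pathstart \<gamma> = z0;
      (f ^^ l) (pathfinish \<gamma>) = (f ^^ k) q\<rbrakk> \<Longrightarrow> ennreal C \<le> kobayashi_length \<Omega> \<gamma>"
    using exists_far_point[OF qA N C] by blast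
  \<comment> \<open>The component need not contain \<open>z0\<close> here: without a joining path
    the infimum in \<open>ennreal\<close> is infinite.\<close>
  have "ennreal C \<le> kobayashi_dist \<Omega> z0 q'" if \<Omega>: "\<Omega> \<in> components A" and q': "q' \<in> Q" for \<Omega> q'
    unfolding kobayashi_dist_def
  proof (rule Inf_greatest)
    fix x assume "x \<in> {kobayashi_length \<Omega> \<gamma> |\<gamma>. valid_path \<gamma> \<and> path_image \<gamma> \<subseteq> \<Omega> \<and>
                                     pathstart \<gamma> = z0 \<and> pathfinish \<gamma> = q'}"
    then obtain \<gamma> where \<gamma>: "x = kobayashi_length \<Omega> \<gamma>" "valid_path \<gamma>" "path_image \<gamma> \<subseteq> \<Omega>"
      "pathstart \<gamma> = z0" "pathfinish \<gamma> = q'" by blast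
    obtain l k where "(f ^^ l) (pathfinish \<gamma>) = (f ^^ k) q" using q' Q \<gamma>(5) by auto
    then show "ennreal C \<le> x"
      using z0(2)[OF open_components[OF oA \<Omega>] _ \<gamma>(2,3,4)] in_components_subset[OF \<Omega>] \<gamma>(1)
      by (simp add: A)
  qed
  then have "z0 \<in> X" using z0(1) unfolding X A by blast
  moreover have "X \<subseteq> A" unfolding X by blast
  ultimately have "frontier A \<subseteq> closure X"
    using frontier_basin_subset_closure[of X] oA fA pull unfolding A by blast
  then show ?thesis using pull by auto
qed

end
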